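(* Let $R$ be a graded-commutative ring and $\mathcal{T}$ an $R$-linear triangulated category. Let $C,M\in\mathcal{T}$ and let $x_1,\ldots,x_t\in R$ be a $(C,C)$-regular sequence. If $M\in\mathrm{thick}_{\mathcal T}(C/\!\!/(x_1,\ldots,x_t))$ and $M\neq 0$, then $$\mathrm{level}^C_{\mathcal T}(M)\ge t+1\,.$$
   Context: A graded-commutative ring is a $\mathbb{Z}$-graded ring $R=\bigoplus_n R_n$ with $xy=(-1)^{|x||y|}yx$; all elements are homogeneous. A triangulated category $\mathcal{T}$ with suspension $\Sigma$ is $R$-linear if it is equipped with a homomorphism of graded rings $R\to Z^*(\mathcal{T})=\bigoplus_{n\in\mathbb{Z}}\{\alpha\colon \mathrm{id}_{\mathcal T}\to\Sigma^n \text{ natural}\mid \alpha\Sigma=(-1)^n\Sigma\alpha\}$. Thus $x\in R$ induces natural morphisms $x\colon M\to\Sigma^{|x|}M$, and $\mathrm{Hom}^*_{\mathcal T}(M,N)=\bigoplus_n\mathrm{Hom}_{\mathcal T}(M,\Sigma^nN)$ is a graded $R$-module. Koszul objects: $M/\!\!/x$ is the cone of $x\colon M\to\Sigma^{|x|}M$, with exact triangle $M\xrightarrow{x}\Sigma^{|x|}M\to M/\!\!/x\to\Sigma M$; inductively $M/\!\!/(x_1,\ldots,x_t)=(M/\!\!/(x_1,\ldots,x_{t-1}))/\!\!/x_t$. The canonical morphism $\Sigma^{-t}M/\!\!/(x_1,\ldots,x_t)\to M$ is the composition $\Sigma^{-t}M/\!\!/(x_1,\ldots,x_t)\to\Sigma^{-t+1}M/\!\!/(x_1,\ldots,x_{t-1})\to\cdots\to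 M$ of (de)suspensions of the last maps of these triangles. A sequence $x_1,\ldots,x_t\in R$ is $(C,M)$-regular if (a) $x_s$ is a non-zero divisor on (acts injectively on) $\mathrm{Hom}^*_{\mathcal T}(C,M/\!\!/(x_1,\ldots,x_{s-1}))$ for $1\le s\le t$, and (b) the canonical morphism $\Sigma^{-t}M/\!\!/(x_1,\ldots,x_t)\to M$ is non-zero. $\mathrm{thick}_{\mathcal T}(X)$ is the smallest thick subcategory containing $X$. Level: $\mathrm{level}^C_{\mathcal T}(N)=0$ if $N\cong0$; it is $1$ if $N\ne0$ can be obtained from $C$ using (de)suspensions, retracts and finite coproducts; otherwise it is the infimum of all $n\ge0$ such that there is an exact triangle $N'\to N\oplus\tilde N\to N''\to\Sigma N'$ with $\mathrm{level}^C_{\mathcal T}(N')=1$ and $\mathrm{level}^C_{\mathcal T}(N'')=n-1$ (and $\infty$ if there is none). *)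

theory Defs
  imports "HOL-Algebra.Ring" "HOL-Library.Extended_Nat"
begin

section \<open>Categories\<close>

record ('o, 'm) category =
  Obj :: "'o set"
  Arr :: "'m set"
  Dom :: "'m \<Rightarrow> 'o"
  Cod :: "'m \<Rightarrow> 'o"
  Ident :: "'o \<Rightarrow> 'm"
  Comp :: "'m \<Rightarrow> 'm \<Rightarrow> 'm"  (infixr \<open>\<cdot>\<index>\<close> 75)

definition Hom :: "('o, 'm, 'x) category_scheme \<Rightarrow> 'o \<Rightarrow> 'o \<Rightarrow> 'm set" where
  "Hom T X Y = {f \<in> Arr T. Dom T f = X \<and> Cod T f = Y}"

locale category =
  fixes T :: "('o, 'm, 'x) category_scheme" (structure)
  assumes Dom_Obj: "f \<in> Arr T \<Longrightarrow> Dom T f \<in> Obj T"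
    and Cod_Obj: "f \<in> Arr T \<Longrightarrow> Cod T f \<in> Obj T"
    and Ident_Hom: "X \<in> Obj T \<Longrightarrow> Ident T X \<in> Hom T X X"
    and Comp_Hom: "f \<in> Hom T X Y \<Longrightarrow> g \<in> Hom T Y Z \<Longrightarrow> g \<cdot> f \<in> Hom T X Z"
    and Comp_Ident: "f \<in> Hom T X Y \<Longrightarrow> f \<cdot> Ident T X = f"
    and Ident_Comp: "f \<in> Hom T X Y \<Longrightarrow> Ident T Y \<cdot> f = f"
    and Comp_assoc: "f \<in> Hom T X Y \<Longrightarrow> g \<in> Hom T Y Z \<Longrightarrow> h \<in> Hom T Z W \<Longrightarrow>
      (h \<cdot> g) \<cdot> f = h \<cdot> (g \<cdot> f)"

definition is_iso :: "('o, 'm, 'x) category_scheme \<Rightarrow> 'o \<Rightarrow> 'o \<Rightarrow> 'm \<Rightarrow> bool" where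
  "is_iso T X Y f \<longleftrightarrow> f \<in> Hom T X Y \<and>
     (\<exists>g \<in> Hom T Y X. g \<cdot>\<^bsub>T\<^esub> f = Ident T X \<and> f \<cdot>\<^bsub>T\<^esub> g = Ident T Y)"

definition is_retract :: "('o, 'm, 'x) category_scheme \<Rightarrow> 'o \<Rightarrow> 'o \<Rightarrow> bool" where
  "is_retract T X Y \<longleftrightarrow> X \<in> Obj T \<and> Y \<in> Obj T \<and>
     (\<exists>i \<in> Hom T X Y. \<exists>p \<in> Hom T Y X. p \<cdot>\<^bsub>T\<^esub> i = Ident T X)"

definition is_zero_obj :: "('o, 'm, 'x) category_scheme \<Rightarrow> 'o \<Rightarrow> bool" where
  "is_zero_obj T Z \<longleftrightarrow> Z \<in> Obj T \<and>
     (\<forall>X \<in> Obj T. (\<exists>!f. f \<in> Hom T X Z) \<and> (\<exists>!f. f \<in> Hom T Z X))"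

definition is_coproduct ::
  "('o, 'm, 'x) category_scheme \<Rightarrow> 'o \<Rightarrow> 'o \<Rightarrow> 'o \<Rightarrow> 'm \<Rightarrow> 'm \<Rightarrow> bool" where
  "is_coproduct T X Y P i j \<longleftrightarrow> P \<in> Obj T \<and> i \<in> Hom T X P \<and> j \<in> Hom T Y P \<and>
     (\<forall>Z \<in> Obj T. \<forall>f \<in> Hom T X Z. \<forall>g \<in> Hom T Y Z.
        \<exists>!k. k \<in> Hom T P Z \<and> k \<cdot>\<^bsub>T\<^esub> i = f \<and> k \<cdot>\<^bsub>T\<^esub> j = g)"


section \<open>Additive categories\<close>

record ('o, 'm) additive_category = "('o, 'm) category" +
  ZeroMor :: "'o \<Rightarrow> 'o \<Rightarrow> 'm"
  AddMor :: "'m \<Rightarrow> 'm \<Rightarrow> 'm"  (infixl \<open>\<oplus>\<oplus>\<index>\<close> 65)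

text \<open>The abelian group of morphisms, in the multiplicative notation of \<open>comm_group\<close>.\<close>

definition Hom_group :: "('o, 'm, 'x) additive_category_scheme \<Rightarrow> 'o \<Rightarrow> 'o \<Rightarrow> 'm monoid" where
  "Hom_group T X Y = \<lparr>carrier = Hom T X Y, mult = AddMor T, one = ZeroMor T X Y\<rparr>"

definition NegMor :: "('o, 'm, 'x) additive_category_scheme \<Rightarrow> 'm \<Rightarrow> 'm" where
  "NegMor T f = inv\<^bsub>Hom_group T (Dom T f) (Cod T f)\<^esub> f"

text \<open>\<open>sign_mult T n f\<close> is \<open>(-1)\<^sup>n f\<close>.\<close>

definition sign_mult :: "('o, 'm, 'x) additive_category_scheme \<Rightarrow> int \<Rightarrow> 'm \<Rightarrow> 'm" where
  "sign_mult T n f = (if even n then f else NegMor T f)"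

locale additive_category = category T
  for T :: "('o, 'm, 'x) additive_category_scheme" (structure) +
  assumes Hom_comm_group: "X \<in> Obj T \<Longrightarrow> Y \<in> Obj T \<Longrightarrow> comm_group (Hom_group T X Y)"
    and Comp_Add_right: "f \<in> Hom T X Y \<Longrightarrow> f' \<in> Hom T X Y \<Longrightarrow> g \<in> Hom T Y Z \<Longrightarrow>
      g \<cdot> (f \<oplus>\<oplus> f') = (g \<cdot> f) \<oplus>\<oplus> (g \<cdot> f')"
    and Comp_Add_left: "f \<in> Hom T X Y \<Longrightarrow> g \<in> Hom T Y Z \<Longrightarrow> g' \<in> Hom T Y Z \<Longrightarrow>
      (g \<oplus>\<oplus> g') \<cdot> f = (g \<cdot> f) \<oplus>\<oplus> (g' \<cdot> f)"
    and ex_zero_obj: "\<exists>Z. is_zero_obj T Z"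
    and ex_coproduct: "X \<in> Obj T \<Longrightarrow> Y \<in> Obj T \<Longrightarrow> \<exists>P i j. is_coproduct T X Y P i j"


section \<open>Triangulated categories\<close>

text \<open>
  The triangle \<open>X \<rightarrow> Y \<rightarrow> Z \<rightarrow> \<Sigma>X\<close> is represented by its three morphisms;
  \<open>Tri\<close> is the class of exact triangles.
\<close>

record ('o, 'm) triangulated_category = "('o, 'm) additive_category" +
  Susp :: "'o \<Rightarrow> 'o"
  SuspMor :: "'m \<Rightarrow> 'm"
  Tri :: "('m \<times> 'm \<times> 'm) set"

definition is_triangle ::
  "('o, 'm, 'x) triangulated_category_scheme \<Rightarrow> 'o \<Rightarrow> 'o \<Rightarrow> 'o \<Rightarrow> 'm \<Rightarrow> 'm \<Rightarrow> 'm \<Rightarrow> bool" where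
  "is_triangle T X Y Z f g h \<longleftrightarrow>
     f \<in> Hom T X Y \<and> g \<in> Hom T Y Z \<and> h \<in> Hom T Z (Susp T X)"

definition is_exact_triangle ::
  "('o, 'm, 'x) triangulated_category_scheme \<Rightarrow> 'o \<Rightarrow> 'o \<Rightarrow> 'o \<Rightarrow> 'm \<Rightarrow> 'm \<Rightarrow> 'm \<Rightarrow> bool" where
  "is_exact_triangle T X Y Z f g h \<longleftrightarrow> is_triangle T X Y Z f g h \<and> (f, g, h) \<in> Tri T"

text \<open>
  As in Verdier's definition, the suspension is an automorphism of the category (and not only an
  equivalence), so that \<open>\<Sigma>\<^sup>m \<Sigma>\<^sup>n = \<Sigma>\<^sup>m\<^sup>+\<^sup>n\<close> holds strictly for all integers \<open>m\<close> and \<open>n\<close>.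
\<close>

locale triangulated_category = additive_category T
  for T :: "('o, 'm, 'x) triangulated_category_scheme" (structure) +
  assumes Susp_bij: "bij_betw (Susp T) (Obj T) (Obj T)"
    and SuspMor_bij: "bij_betw (SuspMor T) (Arr T) (Arr T)"
    and SuspMor_Hom: "f \<in> Hom T X Y \<Longrightarrow> SuspMor T f \<in> Hom T (Susp T X) (Susp T Y)"
    and SuspMor_Ident: "X \<in> Obj T \<Longrightarrow> SuspMor T (Ident T X) = Ident T (Susp T X)"
    and SuspMor_Comp: "f \<in> Hom T X Y \<Longrightarrow> g \<in> Hom T Y Z \<Longrightarrow>
      SuspMor T (g \<cdot> f) = SuspMor T g \<cdot> SuspMor T f"
    and SuspMor_Add: "f \<in> Hom T X Y \<Longrightarrow> f' \<in> Hom T X Y \<Longrightarrow>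
      SuspMor T (f \<oplus>\<oplus> f') = SuspMor T f \<oplus>\<oplus> SuspMor T f'"
    and Tri_triangle: "(f, g, h) \<in> Tri T \<Longrightarrow> \<exists>X Y Z. is_triangle T X Y Z f g h"
    and Tri_iso: "is_exact_triangle T X Y Z f g h \<Longrightarrow> is_triangle T X' Y' Z' f' g' h' \<Longrightarrow>
      is_iso T X X' a \<Longrightarrow> is_iso T Y Y' b \<Longrightarrow> is_iso T Z Z' c \<Longrightarrow>
      b \<cdot> f = f' \<cdot> a \<Longrightarrow> c \<cdot> g = g' \<cdot> b \<Longrightarrow> SuspMor T a \<cdot> h = h' \<cdot> c \<Longrightarrow>
      is_exact_triangle T X' Y' Z' f' g' h'"
    and TR1_Ident: "X \<in> Obj T \<Longrightarrow> is_zero_obj T Z \<Longrightarrow>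
      is_exact_triangle T X X Z (Ident T X) (ZeroMor T X Z) (ZeroMor T Z (Susp T X))"
    and TR1_cone: "f \<in> Hom T X Y \<Longrightarrow> \<exists>Z g h. is_exact_triangle T X Y Z f g h"
    and TR2: "is_triangle T X Y Z f g h \<Longrightarrow>
      is_exact_triangle T X Y Z f g h \<longleftrightarrow>
      is_exact_triangle T Y Z (Susp T X) g h (NegMor T (SuspMor T f))"
    and TR3: "is_exact_triangle T X Y Z f g h \<Longrightarrow> is_exact_triangle T X' Y' Z' f' g' h' \<Longrightarrow>
      a \<in> Hom T X X' \<Longrightarrow> b \<in> Hom T Y Y' \<Longrightarrow> b \<cdot> f = f' \<cdot> a \<Longrightarrow>
      \<exists>c \<in> Hom T Z Z'. c \<cdot> g = g' \<cdot> b \<and> SuspMor T a \<cdot> h = h' \<cdot> c"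
    and TR4: "is_exact_triangle T X Y Z' f i i' \<Longrightarrow> is_exact_triangle T Y Z X' g j j' \<Longrightarrow>
      is_exact_triangle T X Z Y' (g \<cdot> f) k k' \<Longrightarrow>
      \<exists>u v. is_exact_triangle T Z' Y' X' u v (SuspMor T i \<cdot> j') \<and>
        u \<cdot> i = k \<cdot> g \<and> k' \<cdot> u = i' \<and> v \<cdot> k = j \<and> j' \<cdot> v = SuspMor T f \<cdot> k'"

text \<open>Integer powers of a bijection of \<open>A\<close> onto itself.\<close>

definition int_iterate :: "'a set \<Rightarrow> ('a \<Rightarrow> 'a) \<Rightarrow> int \<Rightarrow> 'a \<Rightarrow> 'a" where
  "int_iterate A f n = (if n \<ge> 0 then f ^^ nat n else inv_into A f ^^ nat (- n))"

definition Susp_pow :: "('o, 'm, 'x) triangulated_category_scheme \<Rightarrow> int \<Rightarrow> 'o \<Rightarrow> 'o" where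
  "Susp_pow T = int_iterate (Obj T) (Susp T)"

definition SuspMor_pow :: "('o, 'm, 'x) triangulated_category_scheme \<Rightarrow> int \<Rightarrow> 'm \<Rightarrow> 'm" where
  "SuspMor_pow T = int_iterate (Arr T) (SuspMor T)"


section \<open>Thick subcategories and level\<close>

text \<open>Full subcategories are represented by their classes of objects.\<close>

definition thick_subcategory ::
  "('o, 'm, 'x) triangulated_category_scheme \<Rightarrow> 'o set \<Rightarrow> bool" where
  "thick_subcategory T S \<longleftrightarrow> S \<subseteq> Obj T \<and> (\<forall>Z. is_zero_obj T Z \<longrightarrow> Z \<in> S) \<and>
     (\<forall>n. \<forall>X \<in> S. Susp_pow T n X \<in> S) \<and>
     (\<forall>X Y Z f g h. is_exact_triangle T X Y Z f g h \<longrightarrow>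
        (X \<in> S \<and> Y \<in> S \<longrightarrow> Z \<in> S) \<and> (Y \<in> S \<and> Z \<in> S \<longrightarrow> X \<in> S) \<and> (X \<in> S \<and> Z \<in> S \<longrightarrow> Y \<in> S)) \<and>
     (\<forall>X Y. is_retract T X Y \<and> Y \<in> S \<longrightarrow> X \<in> S)"

definition thick :: "('o, 'm, 'x) triangulated_category_scheme \<Rightarrow> 'o \<Rightarrow> 'o set" where
  "thick T X = \<Inter> {S. thick_subcategory T S \<and> X \<in> S}"

inductive_set built_from :: "('o, 'm, 'x) triangulated_category_scheme \<Rightarrow> 'o \<Rightarrow> 'o set"
  for T :: "('o, 'm, 'x) triangulated_category_scheme" and C :: 'o where
  gen: "C \<in> built_from T C"
| susp: "X \<in> built_from T C \<Longrightarrow> Susp_pow T n X \<in> built_from T C"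
| retract: "Y \<in> built_from T C \<Longrightarrow> is_retract T X Y \<Longrightarrow> X \<in> built_from T C"
| empty_coproduct: "is_zero_obj T Z \<Longrightarrow> Z \<in> built_from T C"
| coproduct: "X \<in> built_from T C \<Longrightarrow> Y \<in> built_from T C \<Longrightarrow> is_coproduct T X Y P i j \<Longrightarrow>
    P \<in> built_from T C"

text \<open>
  \<open>level_step T C N N''\<close>: there is an exact triangle \<open>N' \<rightarrow> N \<oplus> N~ \<rightarrow> N'' \<rightarrow> \<Sigma>N'\<close> in which \<open>N'\<close>
  has level one with respect to \<open>C\<close>.
\<close>

definition level_step ::
  "('o, 'm, 'x) triangulated_category_scheme \<Rightarrow> 'o \<Rightarrow> 'o \<Rightarrow> 'o \<Rightarrow> bool" where
  "level_step T C N N'' \<longleftrightarrow> (\<exists>N' Nt P i j f g h.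
     \<not> is_zero_obj T N' \<and> N' \<in> built_from T C \<and>
     is_coproduct T N Nt P i j \<and> is_exact_triangle T N' P N'' f g h)"

text \<open>
  The usual definition of level is recursive through the finite values of level itself.
  \<open>level_is T C n N\<close> says that this value is the natural number \<open>n\<close>, and it is defined by
  recursion on \<open>n\<close>; \<open>level_eq\<close> below is the recursive equation for \<open>level\<close>.
\<close>

fun level_is :: "('o, 'm, 'x) triangulated_category_scheme \<Rightarrow> 'o \<Rightarrow> nat \<Rightarrow> 'o \<Rightarrow> bool" where
  "level_is T C 0 N \<longleftrightarrow> is_zero_obj T N"
| "level_is T C (Suc n) N \<longleftrightarrow> \<not> is_zero_obj T N \<and>
     (if N \<in> built_from T C then n = 0
      else (\<exists>N''. level_step T C N N'' \<and> level_is T C n N'') \<and>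
           (\<forall>k<n. \<not> (\<exists>N''. level_step T C N N'' \<and> level_is T C k N'')))"

definition level :: "('o, 'm, 'x) triangulated_category_scheme \<Rightarrow> 'o \<Rightarrow> 'o \<Rightarrow> enat" where
  "level T C N = Inf {enat n | n. level_is T C n N}"

lemma level_is_le:
  assumes "level_is T C m N" "level_is T C n N"
  shows "n \<le> m"
proof (cases m; cases n)
  fix m' n' assume eq: "m = Suc m'" "n = Suc n'"
  show ?thesis
  proof (cases "N \<in> built_from T C")
    case True
    then show ?thesis using assms unfolding eq by simp
  next
    case False
    then have "\<not> m' < n'" using assms unfolding eq by auto
    then show ?thesis using eq by simp
  qed
qed (use assms in auto)

lemma level_is_imp_level: "level_is T C n N \<Longrightarrow> level T C N = enat n"
  unfolding level_def
  by (rule antisym, rule Inf_lower, force, rule Inf_greatest) (auto dest: level_is_le)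

lemma level_eq_enat_iff: "level T C N = enat n \<longleftrightarrow> level_is T C n N"
proof
  assume *: "level T C N = enat n"
  have "\<exists>m. level_is T C m N"
  proof (rule ccontr)
    assume "\<nexists>m. level_is T C m N"
    then have "level T C N = \<infinity>" by (simp add: level_def Inf_enat_def)
    with * show False by simp
  qed
  then obtain m where "level_is T C m N" by (rule exE)
  with * show "level_is T C n N" using level_is_imp_level[of T C m N] by simp
qed (rule level_is_imp_level)

lemma level_eq:
  "level T C N =
    (if is_zero_obj T N then 0
     else if N \<in> built_from T C then 1
     else Inf {enat (Suc n) | n. \<exists>N''. level_step T C N N'' \<and> level T C N'' = enat n})"
proof -
  consider "is_zero_obj T N" | "\<not> is_zero_obj T N" "N \<in> built_from T C"
    | "\<not> is_zero_obj T N" "N \<notin> built_from T C" by blast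
  then show ?thesis
  proof cases
    case 1
    then show ?thesis using level_eq_enat_iff[of T C N 0] by (simp add: zero_enat_def)
  next
    case 2
    then show ?thesis using level_eq_enat_iff[of T C N 1] by (simp add: one_enat_def)
  next
    case 3
    define Q where "Q n \<longleftrightarrow> (\<exists>N''. level_step T C N N'' \<and> level_is T C n N'')" for n
    have L: "level_is T C (Suc n) N \<longleftrightarrow> Q n \<and> (\<forall>k<n. \<not> Q k)" for n
      using 3 by (auto simp: Q_def)
    have "level T C N = Inf {enat (Suc n) | n. Q n}"
    proof (cases "\<exists>n. Q n")
      case True
      define m where "m = (LEAST n. Q n)"
      have m: "Q m" "\<And>k. Q k \<Longrightarrow> m \<le> k"
        using True unfolding m_def by (auto intro: LeastI Least_le)
      then have "level_is T C (Suc m) N" using L by (meson not_le)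
      then have "level T C N = enat (Suc m)" by (simp only: level_eq_enat_iff)
      moreover have "Inf {enat (Suc n) | n. Q n} = enat (Suc m)"
      proof (rule antisym)
        show "Inf {enat (Suc n) | n. Q n} \<le> enat (Suc m)" using m by (intro Inf_lower) auto
        show "enat (Suc m) \<le> Inf {enat (Suc n) | n. Q n}" using m by (intro Inf_greatest) auto
      qed
      ultimately show ?thesis by simp
    next
      case False
      have "\<not> level_is T C n N" for n using False 3 L by (cases n) auto
      then show ?thesis using False by (simp add: level_def)
    qed
    then show ?thesis using 3 by (simp add: Q_def level_eq_enat_iff)
  qed
qed


section \<open>Graded-commutative rings and linear triangulated categories\<close>

locale graded_commutative_ring = ring R for R :: "('r, 'y) ring_scheme" (structure) +
  fixes G :: "int \<Rightarrow> 'r set"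
  assumes G_subgroup: "subgroup (G n) (add_monoid R)"
    and G_direct_sum: "x \<in> carrier R \<Longrightarrow>
      \<exists>!c. (\<forall>n. c n \<in> G n) \<and> finite {n. c n \<noteq> \<zero>} \<and> x = (\<Oplus>n \<in> {n. c n \<noteq> \<zero>}. c n)"
    and G_one: "\<one> \<in> G 0"
    and G_mult: "x \<in> G m \<Longrightarrow> y \<in> G n \<Longrightarrow> x \<otimes> y \<in> G (m + n)"
    and G_commute: "x \<in> G m \<Longrightarrow> y \<in> G n \<Longrightarrow>
      x \<otimes> y = (if even (m * n) then y \<otimes> x else \<ominus> (y \<otimes> x))"

text \<open>The degree \<open>n\<close> part of the graded center.\<close>

definition graded_center ::
  "('o, 'm, 'x) triangulated_category_scheme \<Rightarrow> int \<Rightarrow> ('o \<Rightarrow> 'm) set" where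
  "graded_center T n = {\<alpha>.
     (\<forall>X \<in> Obj T. \<alpha> X \<in> Hom T X (Susp_pow T n X)) \<and>
     (\<forall>X Y. \<forall>f \<in> Hom T X Y. \<alpha> Y \<cdot>\<^bsub>T\<^esub> f = SuspMor_pow T n f \<cdot>\<^bsub>T\<^esub> \<alpha> X) \<and>
     (\<forall>X \<in> Obj T. \<alpha> (Susp T X) = sign_mult T n (SuspMor T (\<alpha> X)))}"

text \<open>
  A homomorphism of graded rings from \<open>R\<close> to the graded center, given by its homogeneous
  components \<open>\<phi> n : G n \<rightarrow> graded_center T n\<close>. The degree is an explicit argument because the zero
  of \<open>R\<close> is homogeneous of every degree. The product of \<open>\<alpha>\<close> and \<open>\<beta>\<close> in the graded center is the
  composite \<open>id \<rightarrow> \<Sigma>\<^sup>n \<rightarrow> \<Sigma>\<^sup>m\<^sup>+\<^sup>n\<close> of \<open>\<beta>\<close> and \<open>\<Sigma>\<^sup>n \<alpha>\<close>, where \<open>m\<close> and \<open>n\<close> are the degrees of \<open>\<alpha>\<close> and \<open>\<beta>\<close>.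
\<close>

locale linear_triangulated_category =
  triangulated_category T + graded_commutative_ring R G
  for T :: "('o, 'm, 'x) triangulated_category_scheme"
    and R :: "('r, 'y) ring_scheme"
    and G :: "int \<Rightarrow> 'r set" +
  fixes \<phi> :: "int \<Rightarrow> 'r \<Rightarrow> 'o \<Rightarrow> 'm"
  assumes \<phi>_center: "x \<in> G n \<Longrightarrow> \<phi> n x \<in> graded_center T n"
    and \<phi>_add: "x \<in> G n \<Longrightarrow> y \<in> G n \<Longrightarrow> X \<in> Obj T \<Longrightarrow>
      \<phi> n (x \<oplus>\<^bsub>R\<^esub> y) X = \<phi> n x X \<oplus>\<oplus>\<^bsub>T\<^esub> \<phi> n y X"
    and \<phi>_one: "X \<in> Obj T \<Longrightarrow> \<phi> 0 \<one>\<^bsub>R\<^esub> X = Ident T X"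
    and \<phi>_mult: "x \<in> G m \<Longrightarrow> y \<in> G n \<Longrightarrow> X \<in> Obj T \<Longrightarrow>
      \<phi> (m + n) (x \<otimes>\<^bsub>R\<^esub> y) X = SuspMor_pow T n (\<phi> m x X) \<cdot>\<^bsub>T\<^esub> \<phi> n y X"

text \<open>
  The action of \<open>x \<in> G d\<close> on the degree \<open>n\<close> part \<open>Hom(M, \<Sigma>\<^sup>n N)\<close> of \<open>Hom\<^sup>*(M, N)\<close>, with values in
  \<open>Hom(M, \<Sigma>\<^sup>n\<^sup>+\<^sup>d N)\<close>.
\<close>

definition graded_act ::
  "('o, 'm, 'x) triangulated_category_scheme \<Rightarrow> (int \<Rightarrow> 'r \<Rightarrow> 'o \<Rightarrow> 'm) \<Rightarrow>
   int \<Rightarrow> 'r \<Rightarrow> 'o \<Rightarrow> int \<Rightarrow> 'm \<Rightarrow> 'm" where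
  "graded_act T \<phi> d x N n f = SuspMor_pow T n (\<phi> d x N) \<cdot>\<^bsub>T\<^esub> f"

text \<open>Injectivity on a graded module may be tested degreewise, since \<open>x\<close> is homogeneous.\<close>

definition non_zero_divisor_on_Hom ::
  "('o, 'm, 'x) triangulated_category_scheme \<Rightarrow> (int \<Rightarrow> 'r \<Rightarrow> 'o \<Rightarrow> 'm) \<Rightarrow>
   int \<Rightarrow> 'r \<Rightarrow> 'o \<Rightarrow> 'o \<Rightarrow> bool" where
  "non_zero_divisor_on_Hom T \<phi> d x M N \<longleftrightarrow>
     (\<forall>n. inj_on (graded_act T \<phi> d x N n) (Hom T M (Susp_pow T n N)))"


section \<open>Koszul objects and regular sequences\<close>

text \<open>
  Sequences of homogeneous elements are lists of pairs of a degree and an element of that degree.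

  Cones are unique only up to a non-canonical isomorphism. \<open>koszul_tower T \<phi> M xs K q w\<close> says that
  \<open>K 0, \<dots>, K t\<close> is a choice of Koszul objects, where \<open>K s\<close> is \<open>M // (x\<^sub>1, \<dots>, x\<^sub>s)\<close>, obtained
  from the exact triangles \<open>K s \<rightarrow> \<Sigma>\<^sup>d (K s) \<rightarrow> K (s + 1) \<rightarrow> \<Sigma> (K s)\<close> with morphisms
  \<open>x\<^sub>s\<^sub>+\<^sub>1\<close>, \<open>q s\<close> and \<open>w s\<close>. Since list positions count from zero, \<open>xs ! s\<close> is \<open>x\<^sub>s\<^sub>+\<^sub>1\<close>.
\<close>

definition koszul_tower ::
  "('o, 'm, 'x) triangulated_category_scheme \<Rightarrow> (int \<Rightarrow> 'r \<Rightarrow> 'o \<Rightarrow> 'm) \<Rightarrow>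
   'o \<Rightarrow> (int \<times> 'r) list \<Rightarrow> (nat \<Rightarrow> 'o) \<Rightarrow> (nat \<Rightarrow> 'm) \<Rightarrow> (nat \<Rightarrow> 'm) \<Rightarrow> bool" where
  "koszul_tower T \<phi> M xs K q w \<longleftrightarrow> M \<in> Obj T \<and> K 0 = M \<and>
     (\<forall>s < length xs. case xs ! s of (d, x) \<Rightarrow>
        is_exact_triangle T (K s) (Susp_pow T d (K s)) (K (Suc s)) (\<phi> d x (K s)) (q s) (w s))"

text \<open>
  The canonical morphism \<open>\<Sigma>\<^sup>-\<^sup>s (K s) \<rightarrow> K 0\<close>, where the step from \<open>s + 1\<close> to \<open>s\<close> is the
  desuspension \<open>\<Sigma>\<^sup>-\<^sup>s\<^sup>-\<^sup>1 (w s)\<close>, with codomain \<open>\<Sigma>\<^sup>-\<^sup>s\<^sup>-\<^sup>1 \<Sigma> (K s) = \<Sigma>\<^sup>-\<^sup>s (K s)\<close>.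
\<close>

fun koszul_canonical ::
  "('o, 'm, 'x) triangulated_category_scheme \<Rightarrow> (nat \<Rightarrow> 'o) \<Rightarrow> (nat \<Rightarrow> 'm) \<Rightarrow> nat \<Rightarrow> 'm" where
  "koszul_canonical T K w 0 = Ident T (K 0)"
| "koszul_canonical T K w (Suc s) =
     koszul_canonical T K w s \<cdot>\<^bsub>T\<^esub> SuspMor_pow T (- int (Suc s)) (w s)"

text \<open>
  The sequence \<open>xs\<close> is \<open>(C, M)\<close>-regular, where \<open>M\<close> is the bottom \<open>K 0\<close> of the tower.
\<close>

definition regular_sequence ::
  "('o, 'm, 'x) triangulated_category_scheme \<Rightarrow> (int \<Rightarrow> 'r \<Rightarrow> 'o \<Rightarrow> 'm) \<Rightarrow>
   'o \<Rightarrow> (int \<times> 'r) list \<Rightarrow> (nat \<Rightarrow> 'o) \<Rightarrow> (nat \<Rightarrow> 'm) \<Rightarrow> bool" where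
  "regular_sequence T \<phi> C xs K w \<longleftrightarrow>
     (\<forall>s < length xs. case xs ! s of (d, x) \<Rightarrow> non_zero_divisor_on_Hom T \<phi> d x C (K s)) \<and>
     koszul_canonical T K w (length xs) \<noteq>
       ZeroMor T (Susp_pow T (- int (length xs)) (K (length xs))) (K 0)"

end

theory Submission
  imports Defs
begin

text \<open>
  The proof combines two facts about ghost maps, that is, morphisms that induce zero on
  \<open>Hom\<^sup>*(C, -)\<close>.

  The first is the ghost lemma (\<open>ghosts_level\<close>): if the level of \<open>M\<close> with respect to \<open>C\<close> is at most
  \<open>k\<close>, then every composite of \<open>k\<close> ghost maps that starts at \<open>M\<close> is zero.

  The second is that every morphism \<open>f\<close> from a suspension of \<open>M\<close> to \<open>C\<close> is a composite of \<open>t\<close> ghost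
  maps, where \<open>t\<close> is the length of the sequence (\<open>nilpotent_imp_ghosts\<close>). The square of \<open>\<alpha>\<close>
  vanishes on \<open>N//\<alpha>\<close>, and the objects on which some power of \<open>\<alpha>\<close> vanishes form a thick subcategory;
  hence some power \<open>\<beta>\<close> of each \<open>x\<^sub>i\<close> vanishes on \<open>M\<close>. By naturality the power \<open>\<beta>\<close> of \<open>x\<^sub>1\<close> then
  kills \<open>f\<close>, so that \<open>f\<close> factors through the desuspension of \<open>C//\<beta> \<rightarrow> \<Sigma>C\<close>. This map is a ghost
  because \<open>\<beta>\<close> is a non-zero divisor on \<open>Hom\<^sup>*(C, C)\<close>. The argument is repeated for the other factor
  of \<open>f\<close>, which maps to \<open>C//\<beta>\<close> up to suspension. For this one needs that \<open>x\<^sub>2, \<dots>, x\<^sub>t\<close> is still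
  weakly regular on \<open>Hom\<^sup>*(C, C//\<beta>)\<close>, which is the classical fact that entries of a weakly regular
  sequence may be replaced by powers (\<open>weakly_regular_powers\<close>), applied to the module
  \<open>Hom\<^sup>*(C, C)\<close>; the passage between Koszul objects and quotient modules is
  \<open>weakly_regular_koszul_step\<close>.

  If the level of \<open>M\<close> were at most \<open>t\<close>, the two facts would give \<open>Hom\<^sup>*(M, C) = 0\<close>. The objects \<open>X\<close>
  with \<open>Hom\<^sup>*(M, X) = 0\<close> form a thick subcategory, which would then contain \<open>C\<close>, its Koszul objects
  and \<open>M\<close>; so the identity of \<open>M\<close>, and hence \<open>M\<close>, would be zero.
\<close>

section \<open>Additive categories\<close>

context category
begin

lemma Hom_Arr: "f \<in> Hom T X Y \<Longrightarrow> f \<in> Arr T"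
  by (simp add: Hom_def)

lemma Hom_Dom: "f \<in> Hom T X Y \<Longrightarrow> Dom T f = X"
  by (simp add: Hom_def)

lemma Hom_Cod: "f \<in> Hom T X Y \<Longrightarrow> Cod T f = Y"
  by (simp add: Hom_def)

lemma Hom_Obj:
  assumes "f \<in> Hom T X Y"
  shows "X \<in> Obj T" "Y \<in> Obj T"
  using assms Dom_Obj Cod_Obj by (auto simp: Hom_def)

lemma is_zero_obj_unique:
  assumes "is_zero_obj T Z"
  shows "f \<in> Hom T X Z \<Longrightarrow> g \<in> Hom T X Z \<Longrightarrow> f = g"
    and "f \<in> Hom T Z X \<Longrightarrow> g \<in> Hom T Z X \<Longrightarrow> f = g"
  using assms Hom_Obj unfolding is_zero_obj_def by blast+

end

context additive_category
begin

lemma Zero_Hom: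
  assumes "X \<in> Obj T" "Y \<in> Obj T"
  shows "ZeroMor T X Y \<in> Hom T X Y"
proof -
  interpret comm_group "Hom_group T X Y" using assms by (rule Hom_comm_group)
  show ?thesis using one_closed by (simp add: Hom_group_def)
qed

lemma Add_Hom:
  assumes "f \<in> Hom T X Y" "g \<in> Hom T X Y"
  shows "f \<oplus>\<oplus> g \<in> Hom T X Y"
proof -
  interpret comm_group "Hom_group T X Y" using assms Hom_Obj by (intro Hom_comm_group)
  show ?thesis using m_closed assms by (simp add: Hom_group_def)
qed

lemma Add_assoc:
  assumes "f \<in> Hom T X Y" "g \<in> Hom T X Y" "h \<in> Hom T X Y"
  shows "(f \<oplus>\<oplus> g) \<oplus>\<oplus> h = f \<oplus>\<oplus> (g \<oplus>\<oplus> h)"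
proof -
  interpret comm_group "Hom_group T X Y" using assms Hom_Obj by (intro Hom_comm_group)
  show ?thesis using m_assoc assms by (simp add: Hom_group_def)
qed

lemma Add_commute:
  assumes "f \<in> Hom T X Y" "g \<in> Hom T X Y"
  shows "f \<oplus>\<oplus> g = g \<oplus>\<oplus> f"
proof -
  interpret comm_group "Hom_group T X Y" using assms Hom_Obj by (intro Hom_comm_group)
  show ?thesis using m_comm assms by (simp add: Hom_group_def)
qed

lemma Zero_Add:
  assumes "f \<in> Hom T X Y"
  shows "ZeroMor T X Y \<oplus>\<oplus> f = f"
proof -
  interpret comm_group "Hom_group T X Y" using assms Hom_Obj by (intro Hom_comm_group)
  show ?thesis using l_one assms by (simp add: Hom_group_def)
qed

lemma Add_Zero:
  assumes "f \<in> Hom T X Y"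
  shows "f \<oplus>\<oplus> ZeroMor T X Y = f"
  using assms Zero_Add Add_commute Zero_Hom Hom_Obj by metis

lemma Neg_Hom:
  assumes "f \<in> Hom T X Y"
  shows "NegMor T f \<in> Hom T X Y"
proof -
  interpret comm_group "Hom_group T X Y" using assms Hom_Obj by (intro Hom_comm_group)
  show ?thesis using inv_closed assms by (simp add: Hom_group_def NegMor_def Hom_Dom Hom_Cod)
qed

lemma Neg_Add:
  assumes "f \<in> Hom T X Y"
  shows "NegMor T f \<oplus>\<oplus> f = ZeroMor T X Y"
proof -
  interpret comm_group "Hom_group T X Y" using assms Hom_Obj by (intro Hom_comm_group)
  show ?thesis using l_inv[of f] assms by (simp add: Hom_group_def NegMor_def Hom_Dom Hom_Cod)
qed

lemma Add_Neg:
  assumes "f \<in> Hom T X Y"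
  shows "f \<oplus>\<oplus> NegMor T f = ZeroMor T X Y"
  using assms Neg_Add Neg_Hom Add_commute by metis

lemma Add_left_cancel:
  assumes "f \<in> Hom T X Y" "g \<in> Hom T X Y" "h \<in> Hom T X Y" "f \<oplus>\<oplus> g = f \<oplus>\<oplus> h"
  shows "g = h"
  using assms Add_assoc[OF Neg_Hom[OF assms(1)] assms(1)] Neg_Add Zero_Add by metis

lemma Neg_unique:
  assumes "f \<in> Hom T X Y" "g \<in> Hom T X Y" "f \<oplus>\<oplus> g = ZeroMor T X Y"
  shows "g = NegMor T f"
  using assms Add_left_cancel Add_Neg Neg_Hom by metis

lemma Neg_Neg:
  assumes "f \<in> Hom T X Y"
  shows "NegMor T (NegMor T f) = f"
  using assms Neg_unique Neg_Add Neg_Hom by metis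

lemma Comp_Zero:
  assumes "g \<in> Hom T Y Z" "X \<in> Obj T"
  shows "g \<cdot> ZeroMor T X Y = ZeroMor T X Z"
proof -
  have z: "ZeroMor T X Y \<in> Hom T X Y" using assms Zero_Hom Hom_Obj by blast
  have "g \<cdot> ZeroMor T X Y \<oplus>\<oplus> g \<cdot> ZeroMor T X Y = g \<cdot> ZeroMor T X Y \<oplus>\<oplus> ZeroMor T X Z"
    using Comp_Add_right[OF z z assms(1)] Zero_Add[OF z] Add_Zero[OF Comp_Hom[OF z assms(1)]]
    by simp
  then show ?thesis
    using Add_left_cancel Comp_Hom[OF z assms(1)] Zero_Hom Hom_Obj by metis
qed

lemma Zero_Comp:
  assumes "f \<in> Hom T X Y" "Z \<in> Obj T"
  shows "ZeroMor T Y Z \<cdot> f = ZeroMor T X Z"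
proof -
  have z: "ZeroMor T Y Z \<in> Hom T Y Z" using assms Zero_Hom Hom_Obj by blast
  have "ZeroMor T Y Z \<cdot> f \<oplus>\<oplus> ZeroMor T Y Z \<cdot> f = ZeroMor T Y Z \<cdot> f \<oplus>\<oplus> ZeroMor T X Z"
    using Comp_Add_left[OF assms(1) z z] Zero_Add[OF z] Add_Zero[OF Comp_Hom[OF assms(1) z]]
    by simp
  then show ?thesis
    using Add_left_cancel Comp_Hom[OF assms(1) z] Zero_Hom Hom_Obj by metis
qed

lemma Comp_Neg:
  assumes "f \<in> Hom T X Y" "g \<in> Hom T Y Z"
  shows "g \<cdot> NegMor T f = NegMor T (g \<cdot> f)"
proof (rule Neg_unique)
  show "g \<cdot> f \<in> Hom T X Z" "g \<cdot> NegMor T f \<in> Hom T X Z"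
    using assms Comp_Hom Neg_Hom by blast+
  show "g \<cdot> f \<oplus>\<oplus> g \<cdot> NegMor T f = ZeroMor T X Z"
    using assms Comp_Add_right[OF assms(1) Neg_Hom[OF assms(1)] assms(2)]
    by (simp add: Add_Neg[OF assms(1)] Comp_Zero Hom_Obj)
qed

lemma Neg_Comp:
  assumes "f \<in> Hom T X Y" "g \<in> Hom T Y Z"
  shows "NegMor T g \<cdot> f = NegMor T (g \<cdot> f)"
proof (rule Neg_unique)
  show "g \<cdot> f \<in> Hom T X Z" "NegMor T g \<cdot> f \<in> Hom T X Z"
    using assms Comp_Hom Neg_Hom by blast+
  show "g \<cdot> f \<oplus>\<oplus> NegMor T g \<cdot> f = ZeroMor T X Z"
    using assms Comp_Add_left[OF assms(1) assms(2) Neg_Hom[OF assms(2)]]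
    by (simp add: Add_Neg[OF assms(2)] Zero_Comp Hom_Obj)
qed

lemma Neg_Zero:
  assumes "X \<in> Obj T" "Y \<in> Obj T"
  shows "NegMor T (ZeroMor T X Y) = ZeroMor T X Y"
  using assms Neg_unique Zero_Add Zero_Hom by metis

lemma Neg_eq_Zero_iff:
  assumes "f \<in> Hom T X Y"
  shows "NegMor T f = ZeroMor T X Y \<longleftrightarrow> f = ZeroMor T X Y"
  using assms Neg_Neg Neg_Zero Hom_Obj by metis

lemma Add_cancel_Neg:
  assumes "f \<in> Hom T X Y" "g \<in> Hom T X Y"
  shows "(f \<oplus>\<oplus> NegMor T g) \<oplus>\<oplus> g = f" "(f \<oplus>\<oplus> g) \<oplus>\<oplus> NegMor T g = f"
  using assms by (simp_all add: Add_assoc Neg_Hom Neg_Add Add_Neg Add_Zero)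

lemma is_zero_objI:
  assumes "Z \<in> Obj T" "Ident T Z = ZeroMor T Z Z"
  shows "is_zero_obj T Z"
proof -
  have "f = ZeroMor T X Z" if "f \<in> Hom T X Z" for f X
    using Ident_Comp[OF that] Zero_Comp[OF that] assms by simp
  moreover have "f = ZeroMor T Z X" if "f \<in> Hom T Z X" for f X
    using Comp_Ident[OF that] Comp_Zero[OF that] assms by simp
  ultimately show ?thesis
    unfolding is_zero_obj_def using assms Zero_Hom by blast
qed

lemma zero_obj_Hom:
  assumes "is_zero_obj T Z"
  shows "f \<in> Hom T X Z \<Longrightarrow> f = ZeroMor T X Z" "f \<in> Hom T Z X \<Longrightarrow> f = ZeroMor T Z X"
  using assms is_zero_obj_unique Zero_Hom Hom_Obj by meson+

text \<open>
  The relation \<open>f = \<plusminus>g\<close>. It suffices below, because vanishing and membership in a submodule do not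
  depend on signs.
\<close>

definition up_to_sign :: "'m \<Rightarrow> 'm \<Rightarrow> bool" where
  "up_to_sign f g \<longleftrightarrow> f = g \<or> f = NegMor T g"

lemma up_to_sign_refl [simp]: "up_to_sign f f"
  by (simp add: up_to_sign_def)

lemma up_to_sign_sym: "up_to_sign f g \<Longrightarrow> g \<in> Hom T X Y \<Longrightarrow> up_to_sign g f"
  by (auto simp: up_to_sign_def Neg_Neg)

lemma up_to_sign_Hom: "up_to_sign f g \<Longrightarrow> g \<in> Hom T X Y \<Longrightarrow> f \<in> Hom T X Y"
  by (auto simp: up_to_sign_def Neg_Hom)

lemma up_to_sign_trans:
  "up_to_sign f g \<Longrightarrow> up_to_sign g h \<Longrightarrow> h \<in> Hom T X Y \<Longrightarrow> up_to_sign f h"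
  by (auto simp: up_to_sign_def Neg_Neg)

lemma up_to_sign_Zero_iff:
  "up_to_sign f g \<Longrightarrow> g \<in> Hom T X Y \<Longrightarrow> f = ZeroMor T X Y \<longleftrightarrow> g = ZeroMor T X Y"
  by (auto simp: up_to_sign_def Neg_eq_Zero_iff)

lemma up_to_sign_Comp_left:
  assumes "up_to_sign f f'" "f' \<in> Hom T X Y" "g \<in> Hom T Y Z"
  shows "up_to_sign (g \<cdot> f) (g \<cdot> f')"
  using assms by (auto simp: up_to_sign_def Comp_Neg)

lemma up_to_sign_Comp_right:
  assumes "up_to_sign g g'" "f \<in> Hom T X Y" "g' \<in> Hom T Y Z"
  shows "up_to_sign (g \<cdot> f) (g' \<cdot> f)"
  using assms by (auto simp: up_to_sign_def Neg_Comp)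

lemma sign_mult_up_to_sign: "up_to_sign (sign_mult T n f) f"
  by (simp add: sign_mult_def up_to_sign_def)

lemma sign_mult_Comp:
  assumes "f \<in> Hom T X Y" "g \<in> Hom T Y Z"
  shows "sign_mult T m g \<cdot> sign_mult T n f = sign_mult T (m + n) (g \<cdot> f)"
  using assms Comp_Hom[OF assms] Neg_Hom[OF assms(1)]
  by (auto simp: sign_mult_def Comp_Neg Neg_Comp Neg_Neg)

lemma coproduct_retract:
  assumes "is_coproduct T X Y P i j" "Y \<in> Obj T"
  shows "\<exists>p \<in> Hom T P X. p \<cdot> i = Ident T X"
proof -
  have X: "X \<in> Obj T" using assms Hom_Obj by (auto simp: is_coproduct_def)
  then have "\<exists>!k. k \<in> Hom T P X \<and> k \<cdot> i = Ident T X \<and> k \<cdot> j = ZeroMor T Y X"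
    using assms Ident_Hom Zero_Hom unfolding is_coproduct_def by blast
  then show ?thesis by blast
qed

end

section \<open>Integer powers of the suspension\<close>

lemma int_iterate_in:
  assumes "bij_betw f A A" "a \<in> A"
  shows "int_iterate A f n a \<in> A"
proof -
  have "(f ^^ k) a \<in> A" "(inv_into A f ^^ k) a \<in> A" for k
    using assms by (induction k) (auto simp: bij_betw_def inv_into_into)
  then show ?thesis by (simp add: int_iterate_def)
qed

lemma int_iterate_Suc:
  assumes "bij_betw f A A" "a \<in> A"
  shows "int_iterate A f (n + 1) a = f (int_iterate A f n a)"
proof (cases "n \<ge> 0")
  case True
  then have "nat (n + 1) = Suc (nat n)" by simp
  then show ?thesis using True by (simp add: int_iterate_def)
next
  case False
  define k where "k = nat (- n - 1)"
  have k: "n = - int (Suc k)" using False by (simp add: k_def)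
  have "(inv_into A f ^^ k) a \<in> A"
    using assms by (induction k) (auto simp: bij_betw_def inv_into_into)
  then have "f ((inv_into A f ^^ Suc k) a) = (inv_into A f ^^ k) a"
    using assms by (simp add: bij_betw_def f_inv_into_f)
  then show ?thesis unfolding k by (cases k) (auto simp: int_iterate_def nat_add_distrib)
qed

lemma int_iterate_0 [simp]: "int_iterate A f 0 a = a"
  by (simp add: int_iterate_def)

lemma int_iterate_add:
  assumes "bij_betw f A A" "a \<in> A"
  shows "int_iterate A f (m + n) a = int_iterate A f m (int_iterate A f n a)"
proof (induction m rule: int_induct[where k = 0])
  case base
  show ?case by simp
next
  case (step1 i)
  have "int_iterate A f (i + 1 + n) a = int_iterate A f ((i + n) + 1) a"
    by (simp add: algebra_simps)
  then show ?case
    using step1 int_iterate_Suc[OF assms] int_iterate_Suc[OF assms(1) int_iterate_in[OF assms]]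
    by simp
next
  case (step2 i)
  have "f (int_iterate A f (i - 1 + n) a) = int_iterate A f (i + n) a"
    using int_iterate_Suc[OF assms, of "i - 1 + n"] by (simp add: algebra_simps)
  also have "\<dots> = f (int_iterate A f (i - 1) (int_iterate A f n a))"
    using step2 int_iterate_Suc[OF assms(1) int_iterate_in[OF assms], of "i - 1" n] by simp
  finally show ?case
    using assms int_iterate_in[OF assms] int_iterate_in[OF assms(1) int_iterate_in[OF assms]]
    by (metis bij_betw_def inj_onD)
qed

context triangulated_category
begin

lemma Susp_pow_Obj: "X \<in> Obj T \<Longrightarrow> Susp_pow T n X \<in> Obj T"
  by (simp add: Susp_pow_def int_iterate_in Susp_bij)

lemma Susp_pow_0 [simp]: "Susp_pow T 0 X = X"
  by (simp add: Susp_pow_def)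

lemma Susp_pow_1 [simp]: "Susp_pow T 1 X = Susp T X"
  by (simp add: Susp_pow_def int_iterate_def)

lemma Susp_pow_add: "X \<in> Obj T \<Longrightarrow> Susp_pow T (m + n) X = Susp_pow T m (Susp_pow T n X)"
  by (simp add: Susp_pow_def int_iterate_add Susp_bij)

lemma Susp_pow_commute:
  "X \<in> Obj T \<Longrightarrow> Susp_pow T m (Susp_pow T n X) = Susp_pow T n (Susp_pow T m X)"
  by (metis Susp_pow_add add.commute)

lemma Susp_Obj: "X \<in> Obj T \<Longrightarrow> Susp T X \<in> Obj T"
  using Susp_pow_Obj[of X 1] by simp

lemma Susp_pow_cancel [simp]:
  "X \<in> Obj T \<Longrightarrow> Susp_pow T n (Susp_pow T (- n) X) = X"
  "X \<in> Obj T \<Longrightarrow> Susp_pow T (- n) (Susp_pow T n X) = X"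
  by (simp_all add: Susp_pow_add[symmetric])

lemma SuspMor_pow_Arr: "f \<in> Arr T \<Longrightarrow> SuspMor_pow T n f \<in> Arr T"
  by (simp add: SuspMor_pow_def int_iterate_in SuspMor_bij)

lemma SuspMor_pow_0 [simp]: "SuspMor_pow T 0 f = f"
  by (simp add: SuspMor_pow_def)

lemma SuspMor_pow_1 [simp]: "SuspMor_pow T 1 f = SuspMor T f"
  by (simp add: SuspMor_pow_def int_iterate_def)

lemma SuspMor_pow_add: "f \<in> Arr T \<Longrightarrow>
    SuspMor_pow T (m + n) f = SuspMor_pow T m (SuspMor_pow T n f)"
  by (simp add: SuspMor_pow_def int_iterate_add SuspMor_bij)

lemma SuspMor_pow_cancel [simp]:
  "f \<in> Hom T X Y \<Longrightarrow> SuspMor_pow T n (SuspMor_pow T (- n) f) = f"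
  "f \<in> Hom T X Y \<Longrightarrow> SuspMor_pow T (- n) (SuspMor_pow T n f) = f"
  by (simp_all add: SuspMor_pow_add[symmetric] Hom_Arr)

lemma SuspMor_inj:
  assumes "f \<in> Hom T X Y" "g \<in> Hom T X' Y'" "SuspMor T f = SuspMor T g"
  shows "f = g"
  using assms SuspMor_bij Hom_Arr by (metis bij_betw_def inj_onD)

lemma Desusp_Hom:
  assumes "SuspMor T f \<in> Hom T (Susp T X) (Susp T Y)" "f \<in> Arr T" "X \<in> Obj T" "Y \<in> Obj T"
  shows "f \<in> Hom T X Y"
proof -
  have "f \<in> Hom T (Dom T f) (Cod T f)" using assms by (simp add: Hom_def)
  then have "Susp T (Dom T f) = Susp T X" "Susp T (Cod T f) = Susp T Y"
    using assms SuspMor_Hom Hom_Dom Hom_Cod by metis+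
  then show ?thesis
    using assms Susp_bij Dom_Obj Cod_Obj by (auto simp: Hom_def bij_betw_def inj_on_def)
qed

lemma Susp_pow_Suc: "X \<in> Obj T \<Longrightarrow> Susp_pow T (n + 1) X = Susp T (Susp_pow T n X)"
  by (simp add: Susp_pow_def int_iterate_Suc Susp_bij)

lemma SuspMor_pow_Suc: "f \<in> Arr T \<Longrightarrow> SuspMor_pow T (n + 1) f = SuspMor T (SuspMor_pow T n f)"
  by (simp add: SuspMor_pow_def int_iterate_Suc SuspMor_bij)

lemma SuspMor_pow_Hom:
  assumes "f \<in> Hom T X Y"
  shows "SuspMor_pow T n f \<in> Hom T (Susp_pow T n X) (Susp_pow T n Y)"
proof (induction n rule: int_induct[where k = 0])
  case base
  show ?case using assms by simp
next
  case (step1 i)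
  then show ?case
    using assms Hom_Obj[OF assms] by (simp add: Susp_pow_Suc SuspMor_pow_Suc SuspMor_Hom Hom_Arr)
next
  case (step2 i)
  show ?case
  proof (rule Desusp_Hom)
    show "SuspMor T (SuspMor_pow T (i - 1) f)
        \<in> Hom T (Susp T (Susp_pow T (i - 1) X)) (Susp T (Susp_pow T (i - 1) Y))"
      using step2 assms Hom_Obj[OF assms] Susp_pow_Suc[of _ "i - 1"] SuspMor_pow_Suc[of _ "i - 1"]
      by (simp add: Hom_Arr)
  qed (use assms Hom_Obj[OF assms] in \<open>auto simp: Hom_Arr SuspMor_pow_Arr Susp_pow_Obj\<close>)
qed

lemma SuspMor_pow_eq_iff:
  assumes "f \<in> Hom T X Y" "g \<in> Hom T X' Y'"
  shows "SuspMor_pow T n f = SuspMor_pow T n g \<longleftrightarrow> f = g"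
  using assms SuspMor_pow_cancel(2) by metis

lemma SuspMor_pow_Comp:
  assumes "f \<in> Hom T X Y" "g \<in> Hom T Y Z"
  shows "SuspMor_pow T n (g \<cdot> f) = SuspMor_pow T n g \<cdot> SuspMor_pow T n f"
proof (induction n rule: int_induct[where k = 0])
  case base
  show ?case by simp
next
  case (step1 i)
  then show ?case
    using SuspMor_Comp[OF SuspMor_pow_Hom[OF assms(1)] SuspMor_pow_Hom[OF assms(2)]]
      assms Comp_Hom[OF assms]
    by (simp add: SuspMor_pow_Suc Hom_Arr)
next
  case (step2 i)
  have "SuspMor T (SuspMor_pow T (i - 1) (g \<cdot> f)) =
      SuspMor T (SuspMor_pow T (i - 1) g \<cdot> SuspMor_pow T (i - 1) f)"
    using SuspMor_Comp[OF SuspMor_pow_Hom[OF assms(1)] SuspMor_pow_Hom[OF assms(2)]]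
      assms Comp_Hom[OF assms] step2 SuspMor_pow_Suc[of _ "i - 1"]
    by (simp add: Hom_Arr)
  then show ?case
    using SuspMor_inj SuspMor_pow_Hom assms Comp_Hom by meson
qed

lemma SuspMor_pow_Add:
  assumes "f \<in> Hom T X Y" "g \<in> Hom T X Y"
  shows "SuspMor_pow T n (f \<oplus>\<oplus> g) = SuspMor_pow T n f \<oplus>\<oplus> SuspMor_pow T n g"
proof (induction n rule: int_induct[where k = 0])
  case base
  show ?case by simp
next
  case (step1 i)
  then show ?case
    using SuspMor_Add[OF SuspMor_pow_Hom[OF assms(1)] SuspMor_pow_Hom[OF assms(2)]]
      assms Add_Hom[OF assms]
    by (simp add: SuspMor_pow_Suc Hom_Arr)
next
  case (step2 i)
  have "SuspMor T (SuspMor_pow T (i - 1) (f \<oplus>\<oplus> g)) =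
      SuspMor T (SuspMor_pow T (i - 1) f \<oplus>\<oplus> SuspMor_pow T (i - 1) g)"
    using SuspMor_Add[OF SuspMor_pow_Hom[OF assms(1)] SuspMor_pow_Hom[OF assms(2)]]
      assms Add_Hom[OF assms] step2 SuspMor_pow_Suc[of _ "i - 1"]
    by (simp add: Hom_Arr)
  then show ?case
    using SuspMor_inj SuspMor_pow_Hom assms Add_Hom by meson
qed

lemma SuspMor_pow_Zero:
  assumes "X \<in> Obj T" "Y \<in> Obj T"
  shows "SuspMor_pow T n (ZeroMor T X Y) = ZeroMor T (Susp_pow T n X) (Susp_pow T n Y)"
proof -
  let ?z = "ZeroMor T X Y"
  have z: "?z \<in> Hom T X Y" using assms by (rule Zero_Hom)
  have "SuspMor_pow T n ?z \<oplus>\<oplus> SuspMor_pow T n ?z =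
      SuspMor_pow T n ?z \<oplus>\<oplus> ZeroMor T (Susp_pow T n X) (Susp_pow T n Y)"
    using SuspMor_pow_Add[OF z z, of n] Zero_Add[OF z] Add_Zero[OF SuspMor_pow_Hom[OF z]] by simp
  then show ?thesis
    using Add_left_cancel SuspMor_pow_Hom[OF z] Zero_Hom Susp_pow_Obj assms by metis
qed

lemma SuspMor_pow_Zero_iff:
  assumes "f \<in> Hom T X Y"
  shows "SuspMor_pow T n f = ZeroMor T (Susp_pow T n X) (Susp_pow T n Y) \<longleftrightarrow> f = ZeroMor T X Y"
  using assms SuspMor_pow_Zero SuspMor_pow_eq_iff Zero_Hom Hom_Obj by metis

lemma SuspMor_pow_Neg:
  assumes "f \<in> Hom T X Y"
  shows "SuspMor_pow T n (NegMor T f) = NegMor T (SuspMor_pow T n f)"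
proof (rule Neg_unique)
  show "SuspMor_pow T n f \<oplus>\<oplus> SuspMor_pow T n (NegMor T f) =
      ZeroMor T (Susp_pow T n X) (Susp_pow T n Y)"
    using assms SuspMor_pow_Add[OF assms Neg_Hom[OF assms], of n] Hom_Obj[OF assms]
    by (simp add: Add_Neg SuspMor_pow_Zero)
qed (use assms SuspMor_pow_Hom Neg_Hom in blast)+

lemma SuspMor_pow_Ident:
  assumes "X \<in> Obj T"
  shows "SuspMor_pow T n (Ident T X) = Ident T (Susp_pow T n X)"
proof -
  have I: "SuspMor_pow T n (Ident T X) \<in> Hom T (Susp_pow T n X) (Susp_pow T n X)"
    using assms SuspMor_pow_Hom Ident_Hom by blast
  obtain f where f: "f \<in> Hom T X X" "Ident T (Susp_pow T n X) = SuspMor_pow T n f"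
    using assms SuspMor_pow_Hom[of "Ident T (Susp_pow T n X)" _ _ "- n"] Ident_Hom Susp_pow_Obj
      SuspMor_pow_cancel(1) Susp_pow_cancel(2) by metis
  have "SuspMor_pow T n (Ident T X) = SuspMor_pow T n (Ident T X) \<cdot> SuspMor_pow T n f"
    using Comp_Ident[OF I] f by simp
  also have "\<dots> = SuspMor_pow T n f"
    using SuspMor_pow_Comp[OF f(1) Ident_Hom[OF assms]] Ident_Comp[OF f(1)] by simp
  finally show ?thesis using f by simp
qed

lemma up_to_sign_SuspMor_pow:
  assumes "up_to_sign f g" "g \<in> Hom T X Y"
  shows "up_to_sign (SuspMor_pow T n f) (SuspMor_pow T n g)"
  using assms by (auto simp: up_to_sign_def SuspMor_pow_Neg)

lemma Susp_pow_zero_obj: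
  assumes "is_zero_obj T Z"
  shows "is_zero_obj T (Susp_pow T n Z)"
proof (rule is_zero_objI)
  have Z: "Z \<in> Obj T" using assms by (simp add: is_zero_obj_def)
  then show "Susp_pow T n Z \<in> Obj T" by (rule Susp_pow_Obj)
  have "Ident T Z = ZeroMor T Z Z" using assms Z zero_obj_Hom Ident_Hom by blast
  then show "Ident T (Susp_pow T n Z) = ZeroMor T (Susp_pow T n Z) (Susp_pow T n Z)"
    using Z SuspMor_pow_Ident SuspMor_pow_Zero by metis
qed

end

section \<open>Exactness properties of triangles\<close>

context triangulated_category
begin

lemma exact_triangle_Hom:
  assumes "is_exact_triangle T X Y Z f g h"
  shows "f \<in> Hom T X Y" "g \<in> Hom T Y Z" "h \<in> Hom T Z (Susp T X)"
  using assms by (auto simp: is_exact_triangle_def is_triangle_def)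

lemma exact_triangle_rotate:
  assumes "is_exact_triangle T X Y Z f g h"
  shows "is_exact_triangle T Y Z (Susp T X) g h (NegMor T (SuspMor T f))"
  using assms TR2 by (auto simp: is_exact_triangle_def)

lemma exact_triangle_comp_zero:
  assumes "is_exact_triangle T X Y Z f g h"
  shows "g \<cdot> f = ZeroMor T X Z"
proof -
  note fgh = exact_triangle_Hom[OF assms]
  have X: "X \<in> Obj T" using Hom_Obj fgh by blast
  obtain E where E: "is_zero_obj T E" using ex_zero_obj by blast
  obtain c where "c \<in> Hom T E Z" "c \<cdot> ZeroMor T X E = g \<cdot> f"
    using TR3[OF TR1_Ident[OF X E] assms Ident_Hom[OF X] fgh(1)] by auto
  then show ?thesis using Comp_Zero X by metis
qed

text \<open>
  The functors \<open>Hom(W, -)\<close> and \<open>Hom(-, W)\<close> are exact at \<open>Y\<close> for a triangle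
  \<open>X \<rightarrow> Y \<rightarrow> Z \<rightarrow> \<Sigma>X\<close>.
\<close>

lemma exact_triangle_lift:
  assumes "is_exact_triangle T X Y Z f g h" "b \<in> Hom T W Y" "g \<cdot> b = ZeroMor T W Z"
  shows "\<exists>a \<in> Hom T W X. f \<cdot> a = b"
proof -
  note fgh = exact_triangle_Hom[OF assms(1)]
  have W: "W \<in> Obj T" and X: "X \<in> Obj T" and Y: "Y \<in> Obj T" and Z: "Z \<in> Obj T"
    using Hom_Obj fgh assms by blast+
  obtain E where E: "is_zero_obj T E" using ex_zero_obj by blast
  then have E_Obj: "E \<in> Obj T" by (simp add: is_zero_obj_def)
  have tri: "is_exact_triangle T W E (Susp T W) (ZeroMor T W E) (ZeroMor T E (Susp T W))
      (NegMor T (SuspMor T (Ident T W)))"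
    using exact_triangle_rotate[OF TR1_Ident[OF W E]] .
  obtain c where c: "c \<in> Hom T (Susp T W) (Susp T X)"
      "SuspMor T b \<cdot> NegMor T (SuspMor T (Ident T W)) = NegMor T (SuspMor T f) \<cdot> c"
    using TR3[OF tri exact_triangle_rotate[OF assms(1)] assms(2) Zero_Hom[OF E_Obj Z]]
      Zero_Comp[of "ZeroMor T W E"] Zero_Hom[OF W E_Obj] Z assms(3) by auto
  obtain a where a: "a \<in> Hom T W X" "c = SuspMor T a"
    using SuspMor_pow_Hom[OF c(1), of "-1"] SuspMor_pow_cancel(1)[OF c(1), of 1]
      Susp_pow_cancel(2)[OF W, of 1] Susp_pow_cancel(2)[OF X, of 1] by auto
  have "NegMor T (SuspMor T b) = NegMor T (SuspMor T (f \<cdot> a))"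
    using c(2) W a fgh SuspMor_Hom[OF assms(2)] SuspMor_Hom[OF a(1)] SuspMor_Hom[OF fgh(1)]
      Comp_Neg[OF Ident_Hom[OF Susp_Obj[OF W]]]
    by (simp add: SuspMor_Ident Neg_Comp SuspMor_Comp Comp_Ident)
  then have "SuspMor T b = SuspMor T (f \<cdot> a)"
    using Neg_Neg SuspMor_Hom[OF assms(2)] SuspMor_Hom[OF Comp_Hom[OF a(1) fgh(1)]] by metis
  then have "b = f \<cdot> a"
    using SuspMor_inj assms(2) Comp_Hom[OF a(1) fgh(1)] by blast
  then show ?thesis using a by blast
qed

lemma exact_triangle_extend:
  assumes "is_exact_triangle T X Y Z f g h" "k \<in> Hom T Y W" "k \<cdot> f = ZeroMor T X W"
  shows "\<exists>l \<in> Hom T Z W. l \<cdot> g = k"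
proof -
  note fgh = exact_triangle_Hom[OF assms(1)]
  have W: "W \<in> Obj T" and X: "X \<in> Obj T" using Hom_Obj fgh assms by blast+
  obtain E where E: "is_zero_obj T E" using ex_zero_obj by blast
  then have E_Obj: "E \<in> Obj T" and SE: "is_zero_obj T (Susp T E)"
    using Susp_pow_zero_obj[OF E, of 1] by (simp_all add: is_zero_obj_def)
  have Z: "ZeroMor T E W \<in> Hom T E W" "ZeroMor T W (Susp T E) \<in> Hom T W (Susp T E)"
    using Zero_Hom E_Obj W Susp_Obj by auto
  have "NegMor T (SuspMor T (ZeroMor T E W)) = ZeroMor T (Susp T E) (Susp T W)"
    using SuspMor_pow_Zero[OF E_Obj W, of 1] Neg_Zero Susp_Obj E_Obj W by simp
  then have tri: "is_exact_triangle T E W W (ZeroMor T E W) (Ident T W) (ZeroMor T W (Susp T E))"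
    using TR2[of E W W "ZeroMor T E W" "Ident T W" "ZeroMor T W (Susp T E)"]
      TR1_Ident[OF W SE] Z Ident_Hom[OF W] by (simp add: is_triangle_def)
  have "k \<cdot> f = ZeroMor T E W \<cdot> ZeroMor T X E"
    using assms(3) Zero_Comp[OF Zero_Hom[OF X E_Obj] W] by simp
  then obtain l where "l \<in> Hom T Z W" "l \<cdot> g = Ident T W \<cdot> k"
    using TR3[OF assms(1) tri Zero_Hom[OF X E_Obj] assms(2)] by auto
  then show ?thesis using Ident_Comp[OF assms(2)] by auto
qed

end

section \<open>Elements of the graded center\<close>

context triangulated_category
begin

lemma center_Hom: "\<alpha> \<in> graded_center T d \<Longrightarrow> X \<in> Obj T \<Longrightarrow> \<alpha> X \<in> Hom T X (Susp_pow T d X)"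
  by (simp add: graded_center_def)

lemma center_natural: "\<alpha> \<in> graded_center T d \<Longrightarrow> f \<in> Hom T X Y \<Longrightarrow>
    \<alpha> Y \<cdot> f = SuspMor_pow T d f \<cdot> \<alpha> X"
  unfolding graded_center_def by blast

lemma center_Susp: "\<alpha> \<in> graded_center T d \<Longrightarrow> X \<in> Obj T \<Longrightarrow>
    \<alpha> (Susp T X) = sign_mult T d (SuspMor T (\<alpha> X))"
  by (simp add: graded_center_def)

lemma center_Susp_pow_Hom:
  assumes "\<alpha> \<in> graded_center T d" "X \<in> Obj T"
  shows "SuspMor_pow T n (\<alpha> X) \<in> Hom T (Susp_pow T n X) (Susp_pow T d (Susp_pow T n X))"
  using SuspMor_pow_Hom[OF center_Hom[OF assms]] assms(2) by (metis Susp_pow_commute)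

lemma center_Susp_pow:
  assumes "\<alpha> \<in> graded_center T d" "X \<in> Obj T"
  shows "up_to_sign (\<alpha> (Susp_pow T n X)) (SuspMor_pow T n (\<alpha> X))"
proof (induction n rule: int_induct[where k = 0])
  case base
  show ?case by simp
next
  case (step1 i)
  have "up_to_sign (\<alpha> (Susp_pow T (i + 1) X)) (SuspMor T (\<alpha> (Susp_pow T i X)))"
    using center_Susp[OF assms(1) Susp_pow_Obj[OF assms(2)]] assms(2)
    by (simp add: Susp_pow_Suc sign_mult_up_to_sign)
  moreover have "up_to_sign (SuspMor T (\<alpha> (Susp_pow T i X))) (SuspMor_pow T (i + 1) (\<alpha> X))"
    using up_to_sign_SuspMor_pow[OF step1(2) center_Susp_pow_Hom[OF assms], of 1]
      center_Hom[OF assms] by (simp add: SuspMor_pow_Suc Hom_Arr)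
  ultimately show ?case
    using up_to_sign_trans center_Susp_pow_Hom[OF assms] by blast
next
  case (step2 i)
  let ?Y = "Susp_pow T (i - 1) X"
  have Y: "?Y \<in> Obj T" using assms Susp_pow_Obj by blast
  have a: "\<alpha> ?Y \<in> Hom T ?Y (Susp_pow T d ?Y)"
    using center_Hom assms(1) Y by blast
  have "up_to_sign (\<alpha> (Susp_pow T i X)) (SuspMor T (\<alpha> ?Y))"
    using center_Susp[OF assms(1) Y] assms(2) Susp_pow_Suc[of X "i - 1"]
    by (simp add: sign_mult_up_to_sign)
  then have "up_to_sign (SuspMor T (\<alpha> ?Y)) (\<alpha> (Susp_pow T i X))"
    using up_to_sign_sym SuspMor_Hom a by blast
  then have "up_to_sign (SuspMor T (\<alpha> ?Y)) (SuspMor_pow T i (\<alpha> X))"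
    using up_to_sign_trans step2(2) center_Susp_pow_Hom[OF assms] by blast
  then have "up_to_sign (SuspMor_pow T (-1) (SuspMor T (\<alpha> ?Y)))
      (SuspMor_pow T (-1) (SuspMor_pow T i (\<alpha> X)))"
    using up_to_sign_SuspMor_pow center_Susp_pow_Hom[OF assms] by blast
  then show ?case
    using SuspMor_pow_cancel(2)[OF a, of 1] SuspMor_pow_add[OF Hom_Arr[OF center_Hom[OF assms]], of "-1" i]
    by simp
qed

lemma center_commute:
  assumes "\<alpha> \<in> graded_center T d" "\<beta> \<in> graded_center T e" "X \<in> Obj T"
  shows "up_to_sign (\<alpha> (Susp_pow T e X) \<cdot> \<beta> X) (\<beta> (Susp_pow T d X) \<cdot> \<alpha> X)"
proof -
  have b: "\<beta> (Susp_pow T d X) \<in> Hom T (Susp_pow T d X) (Susp_pow T e (Susp_pow T d X))"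
    using assms center_Hom Susp_pow_Obj by blast
  have "up_to_sign (SuspMor_pow T d (\<beta> X)) (\<beta> (Susp_pow T d X))"
    using up_to_sign_sym[OF center_Susp_pow[OF assms(2,3)] center_Susp_pow_Hom[OF assms(2,3)]] .
  then show ?thesis
    using center_natural[OF assms(1) center_Hom[OF assms(2,3)]]
      up_to_sign_Comp_right[OF _ center_Hom[OF assms(1,3)] b] by simp
qed

text \<open>
  Swapping two central operators in a right module \<open>Hom\<^sup>*(-, N)\<close>: the sign is absorbed
  into \<open>m\<close>.
\<close>

lemma center_swap:
  assumes "\<alpha> \<in> graded_center T d" "\<beta> \<in> graded_center T e" "X \<in> Obj T"
    and k: "k \<in> Hom T (Susp_pow T e (Susp_pow T d X)) N"
  shows "\<exists>m. up_to_sign m k \<and>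
    (k \<cdot> \<beta> (Susp_pow T d X)) \<cdot> \<alpha> X = (m \<cdot> \<alpha> (Susp_pow T e X)) \<cdot> \<beta> X"
proof -
  have H: "\<alpha> X \<in> Hom T X (Susp_pow T d X)" "\<beta> X \<in> Hom T X (Susp_pow T e X)"
    "\<alpha> (Susp_pow T e X) \<in> Hom T (Susp_pow T e X) (Susp_pow T e (Susp_pow T d X))"
    "\<beta> (Susp_pow T d X) \<in> Hom T (Susp_pow T d X) (Susp_pow T e (Susp_pow T d X))"
    using assms center_Hom Susp_pow_Obj Susp_pow_commute by metis+
  have c: "\<alpha> (Susp_pow T e X) \<cdot> \<beta> X \<in> Hom T X (Susp_pow T e (Susp_pow T d X))"
    using Comp_Hom H by blast
  have "up_to_sign (\<beta> (Susp_pow T d X) \<cdot> \<alpha> X) (\<alpha> (Susp_pow T e X) \<cdot> \<beta> X)"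
    using up_to_sign_sym[OF center_commute[OF assms(1-3)]] Comp_Hom H by blast
  then consider "\<beta> (Susp_pow T d X) \<cdot> \<alpha> X = \<alpha> (Susp_pow T e X) \<cdot> \<beta> X"
    | "\<beta> (Susp_pow T d X) \<cdot> \<alpha> X = NegMor T (\<alpha> (Susp_pow T e X) \<cdot> \<beta> X)"
    unfolding up_to_sign_def by blast
  then show ?thesis
  proof cases
    case 1
    then show ?thesis using k H by (intro exI[of _ k]) (simp add: Comp_assoc)
  next
    case 2
    have "k \<cdot> NegMor T (\<alpha> (Susp_pow T e X) \<cdot> \<beta> X) = NegMor T k \<cdot> (\<alpha> (Susp_pow T e X) \<cdot> \<beta> X)"
      using Comp_Neg[OF c k] Neg_Comp[OF c k] by simp
    then show ?thesis
      using 2 k H Neg_Hom[OF k]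
      by (intro exI[of _ "NegMor T k"]) (simp add: Comp_assoc up_to_sign_def)
  qed
qed

lemma center_product:
  assumes "\<alpha> \<in> graded_center T m" "\<beta> \<in> graded_center T n"
  shows "(\<lambda>X. \<alpha> (Susp_pow T n X) \<cdot> \<beta> X) \<in> graded_center T (m + n)"
proof -
  have H: "\<beta> X \<in> Hom T X (Susp_pow T n X)"
    "\<alpha> (Susp_pow T n X) \<in> Hom T (Susp_pow T n X) (Susp_pow T (m + n) X)" if "X \<in> Obj T" for X
    using assms center_Hom Susp_pow_Obj that Susp_pow_add by metis+
  have nat: "(\<alpha> (Susp_pow T n Y) \<cdot> \<beta> Y) \<cdot> f =
      SuspMor_pow T (m + n) f \<cdot> (\<alpha> (Susp_pow T n X) \<cdot> \<beta> X)" if f: "f \<in> Hom T X Y" for f X Y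
  proof -
    note X = Hom_Obj(1)[OF f] and Y = Hom_Obj(2)[OF f]
    note F = SuspMor_pow_Hom[OF f]
    have "(\<alpha> (Susp_pow T n Y) \<cdot> \<beta> Y) \<cdot> f = \<alpha> (Susp_pow T n Y) \<cdot> (SuspMor_pow T n f \<cdot> \<beta> X)"
      using Comp_assoc[OF f H(1)[OF Y] H(2)[OF Y]] center_natural[OF assms(2) f] by simp
    also have "\<dots> = (SuspMor_pow T (m + n) f \<cdot> \<alpha> (Susp_pow T n X)) \<cdot> \<beta> X"
      using Comp_assoc[OF H(1)[OF X] F H(2)[OF Y]] center_natural[OF assms(1) F]
        SuspMor_pow_add[OF Hom_Arr[OF f]] by simp
    also have "\<dots> = SuspMor_pow T (m + n) f \<cdot> (\<alpha> (Susp_pow T n X) \<cdot> \<beta> X)"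
      using Comp_assoc[OF H(1)[OF X] H(2)[OF X] F] .
    finally show ?thesis .
  qed
  have "\<alpha> (Susp_pow T n (Susp T X)) \<cdot> \<beta> (Susp T X) =
      sign_mult T (m + n) (SuspMor T (\<alpha> (Susp_pow T n X) \<cdot> \<beta> X))" if X: "X \<in> Obj T" for X
  proof -
    have "\<alpha> (Susp_pow T n (Susp T X)) = sign_mult T m (SuspMor T (\<alpha> (Susp_pow T n X)))"
      using Susp_pow_commute[OF X, of n 1] center_Susp[OF assms(1) Susp_pow_Obj[OF X]] by simp
    then show ?thesis
      using center_Susp[OF assms(2) X] SuspMor_Comp[OF H[OF X]]
        sign_mult_Comp[OF SuspMor_Hom[OF H(1)[OF X]] SuspMor_Hom[OF H(2)[OF X]]] by simp
  qed
  then show ?thesis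
    using nat H Comp_Hom unfolding graded_center_def by blast
qed

text \<open>
  The positive powers of \<open>\<alpha>\<close>, as pairs of a degree and a central element: the closure of
  \<open>\<alpha>\<close> under multiplication.
\<close>

inductive_set powers :: "int \<Rightarrow> ('o \<Rightarrow> 'm) \<Rightarrow> (int \<times> ('o \<Rightarrow> 'm)) set"
  for d :: int and \<alpha> :: "'o \<Rightarrow> 'm" where
  base: "(d, \<alpha>) \<in> powers d \<alpha>"
| mult: "(m, \<beta>) \<in> powers d \<alpha> \<Longrightarrow> (n, \<gamma>) \<in> powers d \<alpha> \<Longrightarrow>
    (m + n, \<lambda>X. \<beta> (Susp_pow T n X) \<cdot> \<gamma> X) \<in> powers d \<alpha>"

lemma powers_center:
  "(m, \<beta>) \<in> powers d \<alpha> \<Longrightarrow> \<alpha> \<in> graded_center T d \<Longrightarrow> \<beta> \<in> graded_center T m"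
  by (induction rule: powers.induct) (auto intro: center_product)

end

section \<open>Weakly regular sequences on \<open>Hom\<^sup>*(C, N)\<close>\<close>

context additive_category
begin

lemma Add_swap:
  assumes "a \<in> Hom T X Y" "b \<in> Hom T X Y" "c \<in> Hom T X Y" "d \<in> Hom T X Y"
  shows "(a \<oplus>\<oplus> b) \<oplus>\<oplus> (c \<oplus>\<oplus> d) = (a \<oplus>\<oplus> c) \<oplus>\<oplus> (b \<oplus>\<oplus> d)"
proof -
  have "b \<oplus>\<oplus> (c \<oplus>\<oplus> d) = c \<oplus>\<oplus> (b \<oplus>\<oplus> d)"
    using Add_assoc[OF assms(2,3,4)] Add_assoc[OF assms(3,2,4)] Add_commute[OF assms(2,3)] by simp
  then show ?thesis
    using Add_assoc[OF assms(1,2) Add_Hom[OF assms(3,4)]] Add_assoc[OF assms(1,3) Add_Hom[OF assms(2,4)]]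
    by simp
qed

end

context triangulated_category
begin

text \<open>The suspensions and desuspensions of \<open>C\<close>.\<close>

definition orbit :: "'o \<Rightarrow> 'o set" where
  "orbit C = range (\<lambda>n. Susp_pow T n C)"

text \<open>
  The module \<open>Hom\<^sup>*(C, N)\<close> is encoded as the family of groups \<open>Hom(X, N)\<close> for \<open>X\<close> in the orbit of
  \<open>C\<close> under the suspension, on which morphisms of the orbit act on the right. A central \<open>\<alpha>\<close> of
  degree \<open>d\<close> acts by \<open>a \<mapsto> a \<alpha>\<^sub>X\<close> from \<open>Hom(\<Sigma>\<^sup>d X, N)\<close> to \<open>Hom(X, N)\<close>. A submodule is given by the
  set \<open>J\<close> of all its elements; what \<open>J\<close> contains outside \<open>Hom\<^sup>*(C, N)\<close> is irrelevant.
\<close>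

definition submodule :: "'o \<Rightarrow> 'o \<Rightarrow> 'm set \<Rightarrow> bool" where
  "submodule C N J \<longleftrightarrow>
     (\<forall>X \<in> orbit C. ZeroMor T X N \<in> J) \<and>
     (\<forall>X \<in> orbit C. \<forall>a \<in> J \<inter> Hom T X N. \<forall>b \<in> J \<inter> Hom T X N. a \<oplus>\<oplus> b \<in> J) \<and>
     (\<forall>X \<in> orbit C. \<forall>Y \<in> orbit C. \<forall>f \<in> Hom T Y X. \<forall>a \<in> J \<inter> Hom T X N. a \<cdot> f \<in> J)"

definition zero_submodule :: "'o \<Rightarrow> 'o \<Rightarrow> 'm set" where
  "zero_submodule C N = (\<lambda>X. ZeroMor T X N) ` orbit C"

text \<open>The submodule \<open>J + \<alpha> Hom\<^sup>*(C, N)\<close>.\<close>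

definition adjoin :: "'o \<Rightarrow> 'o \<Rightarrow> 'm set \<Rightarrow> int \<Rightarrow> ('o \<Rightarrow> 'm) \<Rightarrow> 'm set" where
  "adjoin C N J d \<alpha> = {b \<oplus>\<oplus> a \<cdot> \<alpha> X | X a b.
     X \<in> orbit C \<and> b \<in> J \<inter> Hom T X N \<and> a \<in> Hom T (Susp_pow T d X) N}"

text \<open>\<open>\<alpha>\<close> is a non-zero divisor on \<open>Hom\<^sup>*(C, N) / J\<close>.\<close>

definition non_zero_divisor_mod :: "'o \<Rightarrow> 'o \<Rightarrow> 'm set \<Rightarrow> int \<Rightarrow> ('o \<Rightarrow> 'm) \<Rightarrow> bool" where
  "non_zero_divisor_mod C N J d \<alpha> \<longleftrightarrow>
     (\<forall>X \<in> orbit C. \<forall>a \<in> Hom T (Susp_pow T d X) N. a \<cdot> \<alpha> X \<in> J \<longrightarrow> a \<in> J)"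

text \<open>
  The sequence is weakly regular on \<open>Hom\<^sup>*(C, N) / J\<close>: each entry is a non-zero divisor modulo
  \<open>J\<close> and the entries before it. The last quotient may be zero.
\<close>

fun weakly_regular :: "'o \<Rightarrow> 'o \<Rightarrow> 'm set \<Rightarrow> (int \<times> ('o \<Rightarrow> 'm)) list \<Rightarrow> bool" where
  "weakly_regular C N J [] \<longleftrightarrow> True"
| "weakly_regular C N J ((d, \<alpha>) # zs) \<longleftrightarrow>
     non_zero_divisor_mod C N J d \<alpha> \<and> weakly_regular C N (adjoin C N J d \<alpha>) zs"

lemma orbit_Obj: "C \<in> Obj T \<Longrightarrow> X \<in> orbit C \<Longrightarrow> X \<in> Obj T"
  by (auto simp: orbit_def Susp_pow_Obj)

lemma orbit_Susp_pow: "C \<in> Obj T \<Longrightarrow> X \<in> orbit C \<Longrightarrow> Susp_pow T n X \<in> orbit C"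
  by (auto simp: orbit_def Susp_pow_add[symmetric])

lemma self_in_orbit: "C \<in> orbit C"
  unfolding orbit_def by (metis Susp_pow_0 rangeI)

lemma submodule_zero: "submodule C N J \<Longrightarrow> X \<in> orbit C \<Longrightarrow> ZeroMor T X N \<in> J"
  by (simp add: submodule_def)

lemma submodule_add: "submodule C N J \<Longrightarrow> X \<in> orbit C \<Longrightarrow> a \<in> J \<Longrightarrow> a \<in> Hom T X N \<Longrightarrow>
    b \<in> J \<Longrightarrow> b \<in> Hom T X N \<Longrightarrow> a \<oplus>\<oplus> b \<in> J"
  unfolding submodule_def by blast

lemma submodule_comp: "submodule C N J \<Longrightarrow> X \<in> orbit C \<Longrightarrow> Y \<in> orbit C \<Longrightarrow> f \<in> Hom T Y X \<Longrightarrow>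
    a \<in> J \<Longrightarrow> a \<in> Hom T X N \<Longrightarrow> a \<cdot> f \<in> J"
  unfolding submodule_def by blast

lemma submodule_neg:
  assumes "submodule C N J" "X \<in> orbit C" "a \<in> J" "a \<in> Hom T X N"
  shows "NegMor T a \<in> J"
proof -
  have I: "Ident T X \<in> Hom T X X" using assms Hom_Obj Ident_Hom by blast
  have "NegMor T a = a \<cdot> NegMor T (Ident T X)"
    using Comp_Neg[OF I assms(4)] Comp_Ident[OF assms(4)] by simp
  then show ?thesis using submodule_comp[OF assms(1,2,2) Neg_Hom[OF I] assms(3,4)] by simp
qed

lemma submodule_sign:
  assumes "submodule C N J" "X \<in> orbit C" "up_to_sign a b" "b \<in> Hom T X N"
  shows "a \<in> J \<longleftrightarrow> b \<in> J"
  using assms submodule_neg Neg_Neg Neg_Hom unfolding up_to_sign_def by metis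

lemma submodule_add_left_iff:
  assumes "submodule C N J" "X \<in> orbit C" "a \<in> J" "a \<in> Hom T X N" "b \<in> Hom T X N"
  shows "a \<oplus>\<oplus> b \<in> J \<longleftrightarrow> b \<in> J"
proof
  assume "a \<oplus>\<oplus> b \<in> J"
  then have "(a \<oplus>\<oplus> b) \<oplus>\<oplus> NegMor T a \<in> J"
    using assms submodule_add submodule_neg Neg_Hom Add_Hom by meson
  then show "b \<in> J" using assms Add_commute Add_cancel_Neg(2) by metis
qed (use assms submodule_add in blast)

lemma zero_submodule_iff:
  assumes "C \<in> Obj T" "X \<in> orbit C" "a \<in> Hom T X N"
  shows "a \<in> zero_submodule C N \<longleftrightarrow> a = ZeroMor T X N"
proof
  have N: "N \<in> Obj T" using assms(3) Hom_Obj by blast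
  assume "a \<in> zero_submodule C N"
  then obtain Y where Y: "Y \<in> orbit C" "a = ZeroMor T Y N" by (auto simp: zero_submodule_def)
  have "Dom T a = Y" unfolding Y(2) using Zero_Hom[OF orbit_Obj[OF assms(1) Y(1)] N] by (rule Hom_Dom)
  then show "a = ZeroMor T X N" using Y(2) Hom_Dom[OF assms(3)] by simp
qed (use assms(2) in \<open>simp add: zero_submodule_def\<close>)

lemma submodule_zero_submodule:
  assumes "C \<in> Obj T" "N \<in> Obj T"
  shows "submodule C N (zero_submodule C N)"
  unfolding submodule_def
proof (intro conjI ballI)
  fix X a b assume *: "X \<in> orbit C" "a \<in> zero_submodule C N \<inter> Hom T X N"
    "b \<in> zero_submodule C N \<inter> Hom T X N"
  then have "a = ZeroMor T X N" using zero_submodule_iff[OF assms(1) *(1)] by blast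
  then show "a \<oplus>\<oplus> b \<in> zero_submodule C N" using * Zero_Add by auto
next
  fix X Y f a assume *: "X \<in> orbit C" "Y \<in> orbit C" "f \<in> Hom T Y X"
    "a \<in> zero_submodule C N \<inter> Hom T X N"
  then have "a \<cdot> f = ZeroMor T Y N"
    using zero_submodule_iff[OF assms(1) *(1)] Zero_Comp[OF *(3) assms(2)] by auto
  then show "a \<cdot> f \<in> zero_submodule C N" using * by (simp add: zero_submodule_def)
qed (simp add: zero_submodule_def)

lemma adjoin_iff:
  assumes "C \<in> Obj T" "X \<in> orbit C" "h \<in> Hom T X N" "\<alpha> \<in> graded_center T d"
  shows "h \<in> adjoin C N J d \<alpha> \<longleftrightarrow>
    (\<exists>b \<in> J \<inter> Hom T X N. \<exists>a \<in> Hom T (Susp_pow T d X) N. h = b \<oplus>\<oplus> a \<cdot> \<alpha> X)"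
proof
  assume "h \<in> adjoin C N J d \<alpha>"
  then obtain Y a b where *: "Y \<in> orbit C" "b \<in> J \<inter> Hom T Y N" "a \<in> Hom T (Susp_pow T d Y) N"
    "h = b \<oplus>\<oplus> a \<cdot> \<alpha> Y" unfolding adjoin_def by blast
  then have "h \<in> Hom T Y N"
    using Add_Hom Comp_Hom[OF center_Hom[OF assms(4) orbit_Obj[OF assms(1)]]] by auto
  then have "X = Y" using assms Hom_Dom by metis
  then show "\<exists>b \<in> J \<inter> Hom T X N. \<exists>a \<in> Hom T (Susp_pow T d X) N. h = b \<oplus>\<oplus> a \<cdot> \<alpha> X"
    using * by blast
qed (use assms in \<open>auto simp: adjoin_def\<close>)

lemma adjoin_base:
  assumes "C \<in> Obj T" "X \<in> orbit C" "N \<in> Obj T" "\<alpha> \<in> graded_center T d" "b \<in> J" "b \<in> Hom T X N"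
  shows "b \<in> adjoin C N J d \<alpha>"
proof -
  have X: "X \<in> Obj T" using assms orbit_Obj by blast
  have "b = b \<oplus>\<oplus> ZeroMor T (Susp_pow T d X) N \<cdot> \<alpha> X"
    using Zero_Comp[OF center_Hom[OF assms(4) X] assms(3)] Add_Zero[OF assms(6)] by simp
  then show ?thesis
    using assms adjoin_iff[OF assms(1,2,6,4)] Zero_Hom[OF Susp_pow_Obj[OF X] assms(3)] by blast
qed

lemma adjoin_mult:
  assumes "C \<in> Obj T" "X \<in> orbit C" "submodule C N J" "\<alpha> \<in> graded_center T d"
    "a \<in> Hom T (Susp_pow T d X) N"
  shows "a \<cdot> \<alpha> X \<in> adjoin C N J d \<alpha>"
proof -
  have X: "X \<in> Obj T" and N: "N \<in> Obj T" using assms orbit_Obj Hom_Obj by blast+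
  have h: "a \<cdot> \<alpha> X \<in> Hom T X N" using Comp_Hom center_Hom assms X by blast
  then have "a \<cdot> \<alpha> X = ZeroMor T X N \<oplus>\<oplus> a \<cdot> \<alpha> X" by (simp add: Zero_Add)
  then show ?thesis
    using assms adjoin_iff[OF assms(1,2) h assms(4)] Zero_Hom[OF X N] submodule_zero by blast
qed

lemma adjoin_zero_iff:
  assumes "C \<in> Obj T" "X \<in> orbit C" "h \<in> Hom T X N" "\<alpha> \<in> graded_center T d"
  shows "h \<in> adjoin C N (zero_submodule C N) d \<alpha> \<longleftrightarrow> (\<exists>a \<in> Hom T (Susp_pow T d X) N. h = a \<cdot> \<alpha> X)"
proof
  assume "h \<in> adjoin C N (zero_submodule C N) d \<alpha>"
  then obtain a b where *: "b \<in> zero_submodule C N" "b \<in> Hom T X N"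
    "a \<in> Hom T (Susp_pow T d X) N" "h = b \<oplus>\<oplus> a \<cdot> \<alpha> X"
    using adjoin_iff[OF assms] by blast
  have "b = ZeroMor T X N" using * zero_submodule_iff assms by blast
  then have "h = a \<cdot> \<alpha> X"
    using * Zero_Add[OF Comp_Hom[OF center_Hom[OF assms(4) Hom_Obj(1)[OF assms(3)]] *(3)]] by simp
  then show "\<exists>a \<in> Hom T (Susp_pow T d X) N. h = a \<cdot> \<alpha> X" using * by blast
qed (use assms adjoin_mult submodule_zero_submodule Hom_Obj in blast)

lemma submodule_adjoin:
  assumes "C \<in> Obj T" "N \<in> Obj T" "submodule C N J" "\<alpha> \<in> graded_center T d"
  shows "submodule C N (adjoin C N J d \<alpha>)"
  unfolding submodule_def
proof (intro conjI ballI)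
  fix X assume X: "X \<in> orbit C"
  show "ZeroMor T X N \<in> adjoin C N J d \<alpha>"
    using adjoin_base[OF assms(1) X assms(2,4) submodule_zero[OF assms(3) X]
        Zero_Hom[OF orbit_Obj[OF assms(1) X] assms(2)]] .
next
  fix X h h' assume X: "X \<in> orbit C" and "h \<in> adjoin C N J d \<alpha> \<inter> Hom T X N"
    "h' \<in> adjoin C N J d \<alpha> \<inter> Hom T X N"
  then obtain a b a' b' where *: "b \<in> J" "b \<in> Hom T X N" "a \<in> Hom T (Susp_pow T d X) N"
    "h = b \<oplus>\<oplus> a \<cdot> \<alpha> X" "b' \<in> J" "b' \<in> Hom T X N" "a' \<in> Hom T (Susp_pow T d X) N"
    "h' = b' \<oplus>\<oplus> a' \<cdot> \<alpha> X"
    using adjoin_iff[OF assms(1) X _ assms(4)] by (metis IntE)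
  have c: "\<alpha> X \<in> Hom T X (Susp_pow T d X)" using center_Hom orbit_Obj assms X by blast
  have "h \<oplus>\<oplus> h' = (b \<oplus>\<oplus> b') \<oplus>\<oplus> (a \<oplus>\<oplus> a') \<cdot> \<alpha> X"
    using Add_swap[OF *(2) Comp_Hom[OF c *(3)] *(6) Comp_Hom[OF c *(7)]]
      Comp_Add_left[OF c *(3,7)] * by simp
  then show "h \<oplus>\<oplus> h' \<in> adjoin C N J d \<alpha>"
    using X * submodule_add[OF assms(3) X] Add_Hom unfolding adjoin_def by blast
next
  fix X Y f h assume X: "X \<in> orbit C" and Y: "Y \<in> orbit C" and f: "f \<in> Hom T Y X"
    and "h \<in> adjoin C N J d \<alpha> \<inter> Hom T X N"
  then obtain a b where *: "b \<in> J" "b \<in> Hom T X N" "a \<in> Hom T (Susp_pow T d X) N"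
    "h = b \<oplus>\<oplus> a \<cdot> \<alpha> X"
    using adjoin_iff[OF assms(1) X _ assms(4)] by (metis IntE)
  have c: "\<alpha> X \<in> Hom T X (Susp_pow T d X)" "\<alpha> Y \<in> Hom T Y (Susp_pow T d Y)"
    using center_Hom orbit_Obj assms X Y by blast+
  have "h \<cdot> f = b \<cdot> f \<oplus>\<oplus> (a \<cdot> SuspMor_pow T d f) \<cdot> \<alpha> Y"
    using Comp_Add_left[OF f *(2) Comp_Hom[OF c(1) *(3)]] Comp_assoc[OF f c(1) *(3)]
      Comp_assoc[OF c(2) SuspMor_pow_Hom[OF f] *(3)] center_natural[OF assms(4) f] *(4) by simp
  then show "h \<cdot> f \<in> adjoin C N J d \<alpha>"
    using Y submodule_comp[OF assms(3) X Y f *(1,2)] Comp_Hom[OF f *(2)]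
      Comp_Hom[OF SuspMor_pow_Hom[OF f] *(3)] unfolding adjoin_def by blast
qed

lemma adjoin_commute_subset:
  assumes "C \<in> Obj T" "N \<in> Obj T" "\<alpha> \<in> graded_center T d" "\<beta> \<in> graded_center T e"
  shows "adjoin C N (adjoin C N J d \<alpha>) e \<beta> \<subseteq> adjoin C N (adjoin C N J e \<beta>) d \<alpha>"
proof
  fix h assume "h \<in> adjoin C N (adjoin C N J d \<alpha>) e \<beta>"
  then obtain X b a where *: "X \<in> orbit C" "b \<in> adjoin C N J d \<alpha>" "b \<in> Hom T X N"
    "a \<in> Hom T (Susp_pow T e X) N" "h = b \<oplus>\<oplus> a \<cdot> \<beta> X" unfolding adjoin_def[of C N _ e] by blast
  then obtain c k where **: "c \<in> J" "c \<in> Hom T X N" "k \<in> Hom T (Susp_pow T d X) N"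
    "b = c \<oplus>\<oplus> k \<cdot> \<alpha> X"
    using adjoin_iff[OF assms(1) *(1,3) assms(3)] by blast
  have H: "a \<cdot> \<beta> X \<in> Hom T X N" "k \<cdot> \<alpha> X \<in> Hom T X N"
    using assms * ** Comp_Hom center_Hom orbit_Obj by blast+
  have "h = (c \<oplus>\<oplus> a \<cdot> \<beta> X) \<oplus>\<oplus> k \<cdot> \<alpha> X"
    using *(5) **(4) Add_assoc[OF **(2) H(2,1)] Add_assoc[OF **(2) H(1,2)] Add_commute[OF H] by simp
  moreover have "c \<oplus>\<oplus> a \<cdot> \<beta> X \<in> adjoin C N J e \<beta>" "c \<oplus>\<oplus> a \<cdot> \<beta> X \<in> Hom T X N"
    using * ** H Add_Hom unfolding adjoin_def by blast+
  ultimately show "h \<in> adjoin C N (adjoin C N J e \<beta>) d \<alpha>"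
    using *(1) **(3) unfolding adjoin_def[of C N _ d] by blast
qed

lemma adjoin_commute:
  assumes "C \<in> Obj T" "N \<in> Obj T" "\<alpha> \<in> graded_center T d" "\<beta> \<in> graded_center T e"
  shows "adjoin C N (adjoin C N J d \<alpha>) e \<beta> = adjoin C N (adjoin C N J e \<beta>) d \<alpha>"
  using assms adjoin_commute_subset by blast

text \<open>
  Write \<open>H\<close> for \<open>Hom\<^sup>*(C, N)\<close>. The last hypothesis says that multiplication by \<open>\<gamma>\<close> gives an exact
  sequence \<open>0 \<rightarrow> H / A \<rightarrow> H / B \<rightarrow> H / (B + \<gamma> H) \<rightarrow> 0\<close>; the lemma states that a sequence that is
  weakly regular on the outer terms is weakly regular on the middle term.
\<close>

lemma weakly_regular_extension:
  assumes "C \<in> Obj T" "N \<in> Obj T" "\<gamma> \<in> graded_center T e"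
    and "\<forall>(d, \<alpha>) \<in> set zs. \<alpha> \<in> graded_center T d"
    and "submodule C N A" "submodule C N B"
    and "weakly_regular C N A zs" "weakly_regular C N (adjoin C N B e \<gamma>) zs"
    and "\<And>X h. X \<in> orbit C \<Longrightarrow> h \<in> Hom T (Susp_pow T e X) N \<Longrightarrow> h \<cdot> \<gamma> X \<in> B \<longleftrightarrow> h \<in> A"
  shows "weakly_regular C N B zs"
  using assms(4-)
proof (induction zs arbitrary: A B)
  case Nil
  show ?case by simp
next
  case (Cons z zs)
  note C = assms(1) and N = assms(2) and \<gamma> = assms(3)
  obtain d \<alpha> where z: "z = (d, \<alpha>)" by force
  have \<alpha>: "\<alpha> \<in> graded_center T d" using Cons.prems(1) z by auto
  note A = Cons.prems(2) and B = Cons.prems(3) and AB = Cons.prems(6)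
  let ?D = "adjoin C N B e \<gamma>"
  have D: "submodule C N ?D" using submodule_adjoin C N B \<gamma> by blast
  have Areg: "\<And>X a. X \<in> orbit C \<Longrightarrow> a \<in> Hom T (Susp_pow T d X) N \<Longrightarrow> a \<cdot> \<alpha> X \<in> A \<Longrightarrow> a \<in> A"
    and Dreg: "\<And>X a. X \<in> orbit C \<Longrightarrow> a \<in> Hom T (Susp_pow T d X) N \<Longrightarrow> a \<cdot> \<alpha> X \<in> ?D \<Longrightarrow> a \<in> ?D"
    using Cons.prems(4,5) z by (auto simp: non_zero_divisor_mod_def)
  have aX: "\<alpha> X \<in> Hom T X (Susp_pow T d X)" and gX: "\<gamma> X \<in> Hom T X (Susp_pow T e X)"
    and SX: "\<And>n. Susp_pow T n X \<in> orbit C"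
    if "X \<in> orbit C" for X
    using that C \<alpha> \<gamma> center_Hom orbit_Obj orbit_Susp_pow by blast+
  \<comment> \<open>The quotient by \<open>D\<close> gives \<open>a = b + k\<gamma>\<close>; then \<open>k\<gamma>\<alpha> = \<plusminus>k\<alpha>\<gamma>\<close> lies in \<open>B\<close>, so \<open>k\<alpha>\<close> and \<open>k\<close> lie in \<open>A\<close>.\<close>
  have reg: "a \<in> B" if X: "X \<in> orbit C" and a: "a \<in> Hom T (Susp_pow T d X) N"
    and aB: "a \<cdot> \<alpha> X \<in> B" for X a
  proof -
    have "a \<in> ?D"
      using Dreg[OF X a] adjoin_base[OF C X N \<gamma> aB] Comp_Hom[OF aX[OF X] a] by blast
    then obtain b k where b: "b \<in> B" "b \<in> Hom T (Susp_pow T d X) N"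
      and k: "k \<in> Hom T (Susp_pow T e (Susp_pow T d X)) N"
      and eq: "a = b \<oplus>\<oplus> k \<cdot> \<gamma> (Susp_pow T d X)"
      using adjoin_iff[OF C SX[OF X] a \<gamma>] by blast
    obtain m where m: "up_to_sign m k"
      "(k \<cdot> \<gamma> (Susp_pow T d X)) \<cdot> \<alpha> X = (m \<cdot> \<alpha> (Susp_pow T e X)) \<cdot> \<gamma> X"
      using center_swap[OF \<alpha> \<gamma> orbit_Obj[OF C X] k] by blast
    have k': "k \<in> Hom T (Susp_pow T d (Susp_pow T e X)) N"
      using k Susp_pow_commute orbit_Obj[OF C X] by metis
    then have mH: "m \<in> Hom T (Susp_pow T d (Susp_pow T e X)) N"
      using m up_to_sign_Hom by blast
    have kg: "k \<cdot> \<gamma> (Susp_pow T d X) \<in> Hom T (Susp_pow T d X) N"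
      using Comp_Hom gX SX X k by blast
    have "b \<cdot> \<alpha> X \<oplus>\<oplus> (m \<cdot> \<alpha> (Susp_pow T e X)) \<cdot> \<gamma> X \<in> B"
      using aB eq Comp_Add_left[OF aX[OF X] b(2) kg] m(2) by simp
    then have "(m \<cdot> \<alpha> (Susp_pow T e X)) \<cdot> \<gamma> X \<in> B"
      using submodule_add_left_iff[OF B X submodule_comp[OF B SX[OF X] X aX[OF X] b]
          Comp_Hom[OF aX[OF X] b(2)]] m(2) Comp_Hom[OF aX[OF X] kg] by simp
    then have "m \<cdot> \<alpha> (Susp_pow T e X) \<in> A"
      using AB X Comp_Hom[OF aX[OF SX[OF X]] mH] by blast
    then have "m \<in> A" using Areg SX X mH by blast
    then have "k \<in> A" using submodule_sign[OF A SX[OF SX[OF X]] m(1) k'] by blast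
    then have "k \<cdot> \<gamma> (Susp_pow T d X) \<in> B" using AB SX X k by blast
    then show "a \<in> B" using eq submodule_add[OF B SX[OF X] b] kg by blast
  qed
  let ?A' = "adjoin C N A d \<alpha>" and ?B' = "adjoin C N B d \<alpha>"
  have A': "submodule C N ?A'" and B': "submodule C N ?B'"
    using submodule_adjoin C N A B \<alpha> by blast+
  \<comment> \<open>The sequence stays exact modulo \<open>\<alpha>\<close> because \<open>\<alpha>\<close> is a non-zero divisor on its last term.\<close>
  have AB': "h \<cdot> \<gamma> X \<in> ?B' \<longleftrightarrow> h \<in> ?A'"
    if X: "X \<in> orbit C" and h: "h \<in> Hom T (Susp_pow T e X) N" for X h
  proof
    have hg: "h \<cdot> \<gamma> X \<in> Hom T X N" using Comp_Hom gX X h by blast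
    assume "h \<cdot> \<gamma> X \<in> ?B'"
    then obtain b k where b: "b \<in> B" "b \<in> Hom T X N" and k: "k \<in> Hom T (Susp_pow T d X) N"
      and eq: "h \<cdot> \<gamma> X = b \<oplus>\<oplus> k \<cdot> \<alpha> X"
      using adjoin_iff[OF C X hg \<alpha>] by blast
    have "b \<oplus>\<oplus> k \<cdot> \<alpha> X \<in> ?D" using adjoin_mult[OF C X B \<gamma> h] eq by simp
    then have "k \<cdot> \<alpha> X \<in> ?D"
      using submodule_add_left_iff[OF D X adjoin_base[OF C X N \<gamma> b] b(2)] Comp_Hom[OF aX[OF X] k]
      by blast
    then have "k \<in> ?D" using Dreg X k by blast
    then obtain b' k' where b': "b' \<in> B" "b' \<in> Hom T (Susp_pow T d X) N"
      and k': "k' \<in> Hom T (Susp_pow T e (Susp_pow T d X)) N"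
      and eq': "k = b' \<oplus>\<oplus> k' \<cdot> \<gamma> (Susp_pow T d X)"
      using adjoin_iff[OF C SX[OF X] k \<gamma>] by blast
    obtain m where m: "up_to_sign m k'"
      "(k' \<cdot> \<gamma> (Susp_pow T d X)) \<cdot> \<alpha> X = (m \<cdot> \<alpha> (Susp_pow T e X)) \<cdot> \<gamma> X"
      using center_swap[OF \<alpha> \<gamma> orbit_Obj[OF C X] k'] by blast
    have mH: "m \<in> Hom T (Susp_pow T d (Susp_pow T e X)) N"
      using m up_to_sign_Hom k' Susp_pow_commute orbit_Obj[OF C X] by metis
    let ?n = "m \<cdot> \<alpha> (Susp_pow T e X)"
    have n: "?n \<in> Hom T (Susp_pow T e X) N" using Comp_Hom aX SX X mH by blast
    have ng: "?n \<cdot> \<gamma> X \<in> Hom T X N" using Comp_Hom gX X n by blast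
    have b'a: "b' \<cdot> \<alpha> X \<in> B" "b' \<cdot> \<alpha> X \<in> Hom T X N"
      using submodule_comp[OF B SX[OF X] X aX[OF X] b'] Comp_Hom[OF aX[OF X] b'(2)] by blast+
    have "h \<cdot> \<gamma> X = b \<oplus>\<oplus> (b' \<cdot> \<alpha> X \<oplus>\<oplus> ?n \<cdot> \<gamma> X)"
      using eq eq' m(2) Comp_Add_left[OF aX[OF X] b'(2) Comp_Hom[OF gX[OF SX[OF X]] k']] by simp
    then have "h \<cdot> \<gamma> X \<oplus>\<oplus> NegMor T (?n \<cdot> \<gamma> X) = b \<oplus>\<oplus> b' \<cdot> \<alpha> X"
      using Add_assoc[OF b(2) b'a(2) ng] Add_cancel_Neg(2)[OF Add_Hom[OF b(2) b'a(2)] ng] by simp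
    then have "(h \<oplus>\<oplus> NegMor T ?n) \<cdot> \<gamma> X \<in> B"
      using Comp_Add_left[OF gX[OF X] h Neg_Hom[OF n]] Neg_Comp[OF gX[OF X] n]
        submodule_add[OF B X b b'a] by simp
    then have "h \<oplus>\<oplus> NegMor T ?n \<in> A"
      using AB X Add_Hom[OF h Neg_Hom[OF n]] by blast
    moreover have "h = (h \<oplus>\<oplus> NegMor T ?n) \<oplus>\<oplus> ?n" using Add_cancel_Neg(1)[OF h n] by simp
    ultimately show "h \<in> ?A'"
      using adjoin_iff[OF C SX[OF X] h \<alpha>] mH Add_Hom[OF h Neg_Hom[OF n]] by blast
  next
    assume "h \<in> ?A'"
    then obtain a k where a: "a \<in> A" "a \<in> Hom T (Susp_pow T e X) N"
      and k: "k \<in> Hom T (Susp_pow T d (Susp_pow T e X)) N" and eq: "h = a \<oplus>\<oplus> k \<cdot> \<alpha> (Susp_pow T e X)"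
      using adjoin_iff[OF C SX[OF X] h \<alpha>] by blast
    obtain m where m: "up_to_sign m k"
      "(k \<cdot> \<alpha> (Susp_pow T e X)) \<cdot> \<gamma> X = (m \<cdot> \<gamma> (Susp_pow T d X)) \<cdot> \<alpha> X"
      using center_swap[OF \<gamma> \<alpha> orbit_Obj[OF C X] k] by blast
    have mH: "m \<in> Hom T (Susp_pow T e (Susp_pow T d X)) N"
      using m up_to_sign_Hom k Susp_pow_commute orbit_Obj[OF C X] by metis
    have ka: "k \<cdot> \<alpha> (Susp_pow T e X) \<in> Hom T (Susp_pow T e X) N"
      using Comp_Hom aX SX X k by blast
    have "h \<cdot> \<gamma> X = a \<cdot> \<gamma> X \<oplus>\<oplus> (m \<cdot> \<gamma> (Susp_pow T d X)) \<cdot> \<alpha> X"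
      using eq m(2) Comp_Add_left[OF gX[OF X] a(2) ka] by simp
    moreover have "a \<cdot> \<gamma> X \<in> B" "a \<cdot> \<gamma> X \<in> Hom T X N"
      using AB X a Comp_Hom gX by blast+
    moreover have "m \<cdot> \<gamma> (Susp_pow T d X) \<in> Hom T (Susp_pow T d X) N"
      using Comp_Hom gX SX X mH by blast
    ultimately show "h \<cdot> \<gamma> X \<in> ?B'" using X unfolding adjoin_def by blast
  qed
  have "weakly_regular C N ?B' zs"
  proof (rule Cons.IH[OF _ A' B'])
    show "weakly_regular C N (adjoin C N ?B' e \<gamma>) zs"
      using Cons.prems(5) z adjoin_commute[OF C N \<alpha> \<gamma>] by simp
  qed (use Cons.prems(1,4) z AB' in auto)
  then show ?case using z reg by (simp add: non_zero_divisor_mod_def)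
qed

text \<open>
  The extension here is \<open>0 \<rightarrow> H / \<beta>H \<rightarrow> H / \<gamma>\<beta>H \<rightarrow> H / \<gamma>H \<rightarrow> 0\<close>, with first map multiplication by \<open>\<gamma>\<close>.
\<close>

lemma weakly_regular_product:
  assumes C: "C \<in> Obj T" and N: "N \<in> Obj T" and \<beta>: "\<beta> \<in> graded_center T m"
    and \<gamma>: "\<gamma> \<in> graded_center T n"
    and zs: "\<forall>(d, \<alpha>) \<in> set zs. \<alpha> \<in> graded_center T d"
    and reg\<beta>: "weakly_regular C N (zero_submodule C N) ((m, \<beta>) # zs)"
    and reg\<gamma>: "weakly_regular C N (zero_submodule C N) ((n, \<gamma>) # zs)"
  shows "weakly_regular C N (zero_submodule C N) ((m + n, \<lambda>X. \<beta> (Susp_pow T n X) \<cdot> \<gamma> X) # zs)"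
proof -
  define \<delta> where "\<delta> = (\<lambda>X. \<beta> (Susp_pow T n X) \<cdot> \<gamma> X)"
  have \<delta>: "\<delta> \<in> graded_center T (m + n)" using center_product[OF \<beta> \<gamma>] by (simp add: \<delta>_def)
  let ?O = "zero_submodule C N"
  have O: "submodule C N ?O" using submodule_zero_submodule C N by blast
  have SX: "Susp_pow T k X \<in> orbit C" if "X \<in> orbit C" for X k
    using that C orbit_Susp_pow by blast
  have gX: "\<gamma> X \<in> Hom T X (Susp_pow T n X)" and bX: "\<beta> X \<in> Hom T X (Susp_pow T m X)"
    if "X \<in> orbit C" for X
    using that C \<beta> \<gamma> center_Hom orbit_Obj by blast+
  have S: "Susp_pow T (m + n) X = Susp_pow T m (Susp_pow T n X)" if "X \<in> orbit C" for X
    using that C orbit_Obj Susp_pow_add by blast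
  have comp: "a \<cdot> \<delta> X = (a \<cdot> \<beta> (Susp_pow T n X)) \<cdot> \<gamma> X"
    if "X \<in> orbit C" "a \<in> Hom T (Susp_pow T (m + n) X) N" for X a
    using that Comp_assoc gX bX SX S unfolding \<delta>_def by metis
  have inj\<gamma>: "a = b" if X: "X \<in> orbit C" and a: "a \<in> Hom T (Susp_pow T n X) N"
    and b: "b \<in> Hom T (Susp_pow T n X) N" and eq: "a \<cdot> \<gamma> X = b \<cdot> \<gamma> X" for X a b
  proof -
    have ab: "a \<oplus>\<oplus> NegMor T b \<in> Hom T (Susp_pow T n X) N" using a b Add_Hom Neg_Hom by blast
    have "(a \<oplus>\<oplus> NegMor T b) \<cdot> \<gamma> X = ZeroMor T X N"
      using Comp_Add_left[OF gX[OF X] a Neg_Hom[OF b]] Neg_Comp[OF gX[OF X] b] eq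
        Add_Neg[OF Comp_Hom[OF gX[OF X] b]] by simp
    then have "(a \<oplus>\<oplus> NegMor T b) \<cdot> \<gamma> X \<in> ?O" using X submodule_zero O by simp
    then have "a \<oplus>\<oplus> NegMor T b \<in> ?O"
      using reg\<gamma> X ab by (auto simp: non_zero_divisor_mod_def)
    then have "a \<oplus>\<oplus> NegMor T b = ZeroMor T (Susp_pow T n X) N"
      using zero_submodule_iff[OF C SX[OF X] ab] by blast
    then show "a = b" using Add_cancel_Neg(1)[OF a b] Zero_Add[OF b] by simp
  qed
  have nzd: "non_zero_divisor_mod C N ?O (m + n) \<delta>"
    unfolding non_zero_divisor_mod_def
  proof (intro ballI impI)
    fix X a assume X: "X \<in> orbit C" and a: "a \<in> Hom T (Susp_pow T (m + n) X) N"
      and "a \<cdot> \<delta> X \<in> ?O"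
    then have "(a \<cdot> \<beta> (Susp_pow T n X)) \<cdot> \<gamma> X \<in> ?O" using comp by simp
    moreover have a': "a \<in> Hom T (Susp_pow T m (Susp_pow T n X)) N" using a S X by simp
    ultimately have "a \<cdot> \<beta> (Susp_pow T n X) \<in> ?O"
      using reg\<gamma> X Comp_Hom[OF bX[OF SX[OF X]] a'] by (auto simp: non_zero_divisor_mod_def)
    then show "a \<in> ?O" using reg\<beta> SX[OF X] a' by (auto simp: non_zero_divisor_mod_def)
  qed
  let ?A = "adjoin C N ?O m \<beta>" and ?B = "adjoin C N ?O (m + n) \<delta>" and ?D = "adjoin C N ?O n \<gamma>"
  have AB: "submodule C N ?A" "submodule C N ?B"
    using submodule_adjoin C N O \<beta> \<delta> by blast+
  have BD: "adjoin C N ?B n \<gamma> = ?D"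
  proof (intro equalityI subsetI)
    fix h assume "h \<in> adjoin C N ?B n \<gamma>"
    then obtain X a b where *: "X \<in> orbit C" "b \<in> ?B" "b \<in> Hom T X N"
      "a \<in> Hom T (Susp_pow T n X) N" "h = b \<oplus>\<oplus> a \<cdot> \<gamma> X" unfolding adjoin_def[of C N _ n] by blast
    obtain c where c: "c \<in> Hom T (Susp_pow T (m + n) X) N" "b = c \<cdot> \<delta> X"
      using adjoin_zero_iff[OF C *(1,3) \<delta>] * by blast
    have c': "c \<cdot> \<beta> (Susp_pow T n X) \<in> Hom T (Susp_pow T n X) N"
      using Comp_Hom[OF bX[OF SX[OF *(1)]]] c S * by simp
    have "h = (c \<cdot> \<beta> (Susp_pow T n X) \<oplus>\<oplus> a) \<cdot> \<gamma> X"
      using * c comp Comp_Add_left[OF gX[OF *(1)] c' *(4)] by simp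
    then show "h \<in> ?D" using adjoin_mult[OF C *(1) O \<gamma>] Add_Hom[OF c' *(4)] by blast
  next
    fix h assume "h \<in> ?D"
    then obtain X a b where *: "X \<in> orbit C" "b \<in> ?O" "b \<in> Hom T X N"
      "a \<in> Hom T (Susp_pow T n X) N" "h = b \<oplus>\<oplus> a \<cdot> \<gamma> X" unfolding adjoin_def by blast
    then have "b \<in> ?B" using adjoin_base C N \<delta> by blast
    then show "h \<in> adjoin C N ?B n \<gamma>" using * unfolding adjoin_def[of C N ?B] by blast
  qed
  have "weakly_regular C N ?B zs"
  proof (rule weakly_regular_extension[OF C N \<gamma> zs AB])
    show "weakly_regular C N ?A zs" using reg\<beta> by simp
    show "weakly_regular C N (adjoin C N ?B n \<gamma>) zs" using reg\<gamma> BD by simp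
  next
    fix X h assume X: "X \<in> orbit C" and h: "h \<in> Hom T (Susp_pow T n X) N"
    have hg: "h \<cdot> \<gamma> X \<in> Hom T X N" using Comp_Hom gX X h by blast
    have "h \<cdot> \<gamma> X \<in> ?B \<longleftrightarrow> (\<exists>a \<in> Hom T (Susp_pow T (m + n) X) N. h \<cdot> \<gamma> X = (a \<cdot> \<beta> (Susp_pow T n X)) \<cdot> \<gamma> X)"
      using adjoin_zero_iff[OF C X hg \<delta>] comp[OF X] by auto
    also have "\<dots> \<longleftrightarrow> (\<exists>a \<in> Hom T (Susp_pow T m (Susp_pow T n X)) N. h = a \<cdot> \<beta> (Susp_pow T n X))"
      using inj\<gamma>[OF X h, OF Comp_Hom[OF bX[OF SX[OF X]]]] S[OF X] by auto
    also have "\<dots> \<longleftrightarrow> h \<in> ?A" using adjoin_zero_iff[OF C SX[OF X] h \<beta>] by simp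
    finally show "h \<cdot> \<gamma> X \<in> ?B \<longleftrightarrow> h \<in> ?A" .
  qed
  then show ?thesis using nzd by (simp add: \<delta>_def)
qed

text \<open>The first entry of a weakly regular sequence may be replaced by a power of it.\<close>

lemma weakly_regular_powers:
  assumes "(e, \<beta>) \<in> powers d \<alpha>" "C \<in> Obj T" "N \<in> Obj T" "\<alpha> \<in> graded_center T d"
    "\<forall>(d, \<alpha>) \<in> set zs. \<alpha> \<in> graded_center T d"
    "weakly_regular C N (zero_submodule C N) ((d, \<alpha>) # zs)"
  shows "weakly_regular C N (zero_submodule C N) ((e, \<beta>) # zs)"
  using assms(1)
proof induction
  case base
  show ?case using assms(6) .
next
  case (mult m \<beta> n \<gamma>)
  then show ?case using weakly_regular_product assms powers_center by blast
qed

text \<open>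
  Weak regularity is invariant under a surjection \<open>Hom\<^sup>*(C, N) \<rightarrow> Hom\<^sup>*(C, L)\<close> of degree \<open>d\<close> that is
  induced by a morphism \<open>\<Sigma>\<^sup>d N \<rightarrow> L\<close>; here \<open>I\<close> is the preimage of \<open>J\<close>, so that the two quotients
  agree. The map is linear over the center only up to sign, which submodules do not see.
\<close>

lemma weakly_regular_transport:
  assumes "C \<in> Obj T" "N \<in> Obj T" "g \<in> Hom T (Susp_pow T d N) L"
    and "\<And>X b. X \<in> orbit C \<Longrightarrow> b \<in> Hom T (Susp_pow T d X) L \<Longrightarrow>
      \<exists>a \<in> Hom T X N. g \<cdot> SuspMor_pow T d a = b"
    and "\<forall>(e, \<alpha>) \<in> set zs. \<alpha> \<in> graded_center T e"
    and "submodule C N I" "submodule C L J"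
    and "\<And>X a. X \<in> orbit C \<Longrightarrow> a \<in> Hom T X N \<Longrightarrow> g \<cdot> SuspMor_pow T d a \<in> J \<longleftrightarrow> a \<in> I"
  shows "weakly_regular C L J zs \<longleftrightarrow> weakly_regular C N I zs"
  using assms(5-)
proof (induction zs arbitrary: I J)
  case Nil
  show ?case by simp
next
  case (Cons z zs)
  note C = assms(1) and N = assms(2) and g = assms(3) and surj = assms(4)
  obtain e \<alpha> where z: "z = (e, \<alpha>)" by force
  have \<alpha>: "\<alpha> \<in> graded_center T e" using Cons.prems(1) z by auto
  have L: "L \<in> Obj T" using g Hom_Obj by blast
  note I = Cons.prems(2) and J = Cons.prems(3) and IJ = Cons.prems(4)
  let ?\<rho> = "\<lambda>a. g \<cdot> SuspMor_pow T d a"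
  have \<rho>: "?\<rho> a \<in> Hom T (Susp_pow T d X) L" if "a \<in> Hom T X N" for a X
    using Comp_Hom[OF SuspMor_pow_Hom[OF that] g] .
  have SX: "Susp_pow T n X \<in> orbit C" if "X \<in> orbit C" for n X
    using orbit_Susp_pow[OF C that] .
  have aX: "\<alpha> X \<in> Hom T X (Susp_pow T e X)" if "X \<in> orbit C" for X
    using center_Hom[OF \<alpha> orbit_Obj[OF C that]] .
  have comm: "Susp_pow T d (Susp_pow T e X) = Susp_pow T e (Susp_pow T d X)" if "X \<in> orbit C" for X
    using Susp_pow_commute[OF orbit_Obj[OF C that]] .
  have lin: "up_to_sign (?\<rho> (a \<cdot> \<alpha> X)) (?\<rho> a \<cdot> \<alpha> (Susp_pow T d X))"
    and \<rho>a: "?\<rho> a \<in> Hom T (Susp_pow T e (Susp_pow T d X)) L"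
    and \<rho>a\<alpha>: "?\<rho> a \<cdot> \<alpha> (Susp_pow T d X) \<in> Hom T (Susp_pow T d X) L"
    if X: "X \<in> orbit C" and a: "a \<in> Hom T (Susp_pow T e X) N" for X a
  proof -
    show \<rho>a: "?\<rho> a \<in> Hom T (Susp_pow T e (Susp_pow T d X)) L"
      using \<rho>[OF a] comm[OF X] by simp
    show "?\<rho> a \<cdot> \<alpha> (Susp_pow T d X) \<in> Hom T (Susp_pow T d X) L"
      using Comp_Hom[OF aX[OF SX[OF X]] \<rho>a] .
    have "up_to_sign (SuspMor_pow T d (\<alpha> X)) (\<alpha> (Susp_pow T d X))"
      using up_to_sign_sym[OF center_Susp_pow[OF \<alpha> orbit_Obj[OF C X]]
          center_Susp_pow_Hom[OF \<alpha> orbit_Obj[OF C X]]] .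
    then have "up_to_sign (?\<rho> a \<cdot> SuspMor_pow T d (\<alpha> X)) (?\<rho> a \<cdot> \<alpha> (Susp_pow T d X))"
      using up_to_sign_Comp_left aX[OF SX[OF X]] \<rho>a by blast
    then show "up_to_sign (?\<rho> (a \<cdot> \<alpha> X)) (?\<rho> a \<cdot> \<alpha> (Susp_pow T d X))"
      using SuspMor_pow_Comp[OF aX[OF X] a]
        Comp_assoc[OF SuspMor_pow_Hom[OF aX[OF X]] SuspMor_pow_Hom[OF a] g] by simp
  qed
  have mem: "?\<rho> a \<cdot> \<alpha> (Susp_pow T d X) \<in> J \<longleftrightarrow> a \<cdot> \<alpha> X \<in> I"
    if X: "X \<in> orbit C" and a: "a \<in> Hom T (Susp_pow T e X) N" for X a
    using submodule_sign[OF J SX[OF X] lin[OF X a] \<rho>a\<alpha>[OF X a]] IJ[OF X Comp_Hom[OF aX[OF X] a]]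
    by simp
  have "non_zero_divisor_mod C L J e \<alpha> \<longleftrightarrow> non_zero_divisor_mod C N I e \<alpha>"
    unfolding non_zero_divisor_mod_def
  proof (intro iffI ballI impI)
    fix X a assume *: "\<forall>X \<in> orbit C. \<forall>a \<in> Hom T (Susp_pow T e X) L. a \<cdot> \<alpha> X \<in> J \<longrightarrow> a \<in> J"
      and X: "X \<in> orbit C" and a: "a \<in> Hom T (Susp_pow T e X) N" and "a \<cdot> \<alpha> X \<in> I"
    then have "?\<rho> a \<in> J" using mem[OF X a] \<rho>a[OF X a] SX[OF X] by blast
    then show "a \<in> I" using IJ[OF SX[OF X] a] by blast
  next
    fix Y b assume *: "\<forall>X \<in> orbit C. \<forall>a \<in> Hom T (Susp_pow T e X) N. a \<cdot> \<alpha> X \<in> I \<longrightarrow> a \<in> I"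
      and Y: "Y \<in> orbit C" and b: "b \<in> Hom T (Susp_pow T e Y) L" "b \<cdot> \<alpha> Y \<in> J"
    define X where "X = Susp_pow T (- d) Y"
    have X: "X \<in> orbit C" "Y = Susp_pow T d X"
      using Y SX orbit_Obj[OF C] by (simp_all add: X_def)
    obtain a where a: "a \<in> Hom T (Susp_pow T e X) N" "?\<rho> a = b"
      using surj[OF SX[OF X(1)]] b(1) X comm by metis
    then have "a \<in> I" using * X b(2) mem[OF X(1) a(1)] by simp
    then show "b \<in> J" using IJ[OF SX[OF X(1)] a(1)] a by blast
  qed
  moreover have "weakly_regular C L (adjoin C L J e \<alpha>) zs \<longleftrightarrow>
      weakly_regular C N (adjoin C N I e \<alpha>) zs"
  proof (rule Cons.IH)
    show "submodule C N (adjoin C N I e \<alpha>)" "submodule C L (adjoin C L J e \<alpha>)"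
      using submodule_adjoin[OF C N I \<alpha>] submodule_adjoin[OF C L J \<alpha>] .
  next
    fix X a assume X: "X \<in> orbit C" and a: "a \<in> Hom T X N"
    have \<rho>_add: "?\<rho> (b \<oplus>\<oplus> c) = ?\<rho> b \<oplus>\<oplus> ?\<rho> c" if "b \<in> Hom T X N" "c \<in> Hom T X N" for b c
      using SuspMor_pow_Add[OF that] Comp_Add_right[OF SuspMor_pow_Hom[OF that(1)]
          SuspMor_pow_Hom[OF that(2)] g] by simp
    show "?\<rho> a \<in> adjoin C L J e \<alpha> \<longleftrightarrow> a \<in> adjoin C N I e \<alpha>"
    proof
      assume "a \<in> adjoin C N I e \<alpha>"
      then obtain b k where b: "b \<in> I" "b \<in> Hom T X N" and k: "k \<in> Hom T (Susp_pow T e X) N"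
        and eq: "a = b \<oplus>\<oplus> k \<cdot> \<alpha> X"
        using adjoin_iff[OF C X a \<alpha>] by blast
      have "?\<rho> k \<cdot> \<alpha> (Susp_pow T d X) \<in> adjoin C L J e \<alpha>"
        using adjoin_mult[OF C SX[OF X] J \<alpha> \<rho>a[OF X k]] .
      then have "?\<rho> (k \<cdot> \<alpha> X) \<in> adjoin C L J e \<alpha>"
        using submodule_sign[OF submodule_adjoin[OF C L J \<alpha>] SX[OF X] lin[OF X k] \<rho>a\<alpha>[OF X k]]
        by blast
      moreover have "?\<rho> b \<in> adjoin C L J e \<alpha>"
        using adjoin_base[OF C SX[OF X] L \<alpha> _ \<rho>[OF b(2)]] IJ[OF X b(2)] b(1) by blast
      ultimately show "?\<rho> a \<in> adjoin C L J e \<alpha>"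
        using submodule_add[OF submodule_adjoin[OF C L J \<alpha>] SX[OF X]] \<rho>[OF b(2)]
          \<rho>[OF Comp_Hom[OF aX[OF X] k]] \<rho>_add[OF b(2) Comp_Hom[OF aX[OF X] k]] eq by simp
    next
      assume "?\<rho> a \<in> adjoin C L J e \<alpha>"
      then obtain b k where b: "b \<in> J" "b \<in> Hom T (Susp_pow T d X) L"
        and k: "k \<in> Hom T (Susp_pow T e (Susp_pow T d X)) L"
        and eq: "?\<rho> a = b \<oplus>\<oplus> k \<cdot> \<alpha> (Susp_pow T d X)"
        using adjoin_iff[OF C SX[OF X] \<rho>[OF a] \<alpha>] by blast
      obtain k' where k': "k' \<in> Hom T (Susp_pow T e X) N" "?\<rho> k' = k"
        using surj[OF SX[OF X]] k comm[OF X] by metis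
      have c: "k' \<cdot> \<alpha> X \<in> Hom T X N" using Comp_Hom[OF aX[OF X] k'(1)] .
      obtain m where m: "m \<in> Hom T (Susp_pow T e X) N" "?\<rho> (m \<cdot> \<alpha> X) = k \<cdot> \<alpha> (Susp_pow T d X)"
      proof -
        have "?\<rho> (NegMor T k' \<cdot> \<alpha> X) = NegMor T (?\<rho> (k' \<cdot> \<alpha> X))"
          using Neg_Comp[OF aX[OF X] k'(1)] SuspMor_pow_Neg[OF c] Comp_Neg[OF SuspMor_pow_Hom[OF c] g]
          by simp
        moreover have "up_to_sign (k \<cdot> \<alpha> (Susp_pow T d X)) (?\<rho> (k' \<cdot> \<alpha> X))"
          using up_to_sign_sym[OF lin[OF X k'(1)] \<rho>a\<alpha>[OF X k'(1)]] k'(2) by simp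
        ultimately show ?thesis
          using that k'(1) Neg_Hom[OF k'(1)] unfolding up_to_sign_def by metis
      qed
      let ?n = "m \<cdot> \<alpha> X"
      have n: "?n \<in> Hom T X N" using Comp_Hom[OF aX[OF X] m(1)] .
      have h: "a \<oplus>\<oplus> NegMor T ?n \<in> Hom T X N" using Add_Hom[OF a Neg_Hom[OF n]] .
      have "?\<rho> (a \<oplus>\<oplus> NegMor T ?n) = (b \<oplus>\<oplus> ?\<rho> ?n) \<oplus>\<oplus> NegMor T (?\<rho> ?n)"
        using \<rho>_add[OF a Neg_Hom[OF n]] SuspMor_pow_Neg[OF n]
          Comp_Neg[OF SuspMor_pow_Hom[OF n] g] eq m(2) by simp
      then have "?\<rho> (a \<oplus>\<oplus> NegMor T ?n) = b" using Add_cancel_Neg(2)[OF b(2) \<rho>[OF n]] by simp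
      then have "a \<oplus>\<oplus> NegMor T ?n \<in> I" using IJ[OF X h] b(1) by simp
      moreover have "a = (a \<oplus>\<oplus> NegMor T ?n) \<oplus>\<oplus> ?n" using Add_cancel_Neg(1)[OF a n] by simp
      ultimately show "a \<in> adjoin C N I e \<alpha>" using adjoin_iff[OF C X a \<alpha>] h m(1) by blast
    qed
  qed (use Cons.prems(1) in auto)
  ultimately show ?case using z by simp
qed

end

section \<open>Ghost maps\<close>

context triangulated_category
begin

text \<open>A ghost map \<open>w\<close> from \<open>Y\<close> to \<open>Z\<close>: the induced map on \<open>Hom\<^sup>*(C, -)\<close> is zero.\<close>

definition ghost :: "'o \<Rightarrow> 'o \<Rightarrow> 'o \<Rightarrow> 'm \<Rightarrow> bool" where
  "ghost C Y Z w \<longleftrightarrow> w \<in> Hom T Y Z \<and>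
     (\<forall>X \<in> orbit C. \<forall>a \<in> Hom T X Y. w \<cdot> a = ZeroMor T X Z)"

text \<open>\<open>ghosts C k Y Z f\<close>: the morphism \<open>f\<close> from \<open>Y\<close> to \<open>Z\<close> is a composite of \<open>k\<close> ghost maps.\<close>

fun ghosts :: "'o \<Rightarrow> nat \<Rightarrow> 'o \<Rightarrow> 'o \<Rightarrow> 'm \<Rightarrow> bool" where
  "ghosts C 0 Y Z f \<longleftrightarrow> f \<in> Hom T Y Z"
| "ghosts C (Suc k) Y Z f \<longleftrightarrow> (\<exists>V g w. ghost C Y V w \<and> ghosts C k V Z g \<and> f = g \<cdot> w)"

lemma ghost_Hom: "ghost C Y Z w \<Longrightarrow> w \<in> Hom T Y Z"
  by (simp add: ghost_def)

lemma ghosts_Hom: "ghosts C k Y Z f \<Longrightarrow> f \<in> Hom T Y Z"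
proof (induction k arbitrary: Y f)
  case (Suc k)
  then obtain V g w where "ghost C Y V w" "ghosts C k V Z g" "f = g \<cdot> w" by auto
  then show ?case using Suc.IH Comp_Hom ghost_Hom by blast
qed simp

lemma ghost_precomp:
  assumes "ghost C Y Z w" "h \<in> Hom T X Y"
  shows "ghost C X Z (w \<cdot> h)"
proof -
  have "(w \<cdot> h) \<cdot> a = ZeroMor T V Z" if "V \<in> orbit C" "a \<in> Hom T V X" for V a
    using that assms Comp_assoc[OF that(2) assms(2) ghost_Hom[OF assms(1)]]
      Comp_Hom[OF that(2) assms(2)] by (simp add: ghost_def)
  then show ?thesis using assms Comp_Hom by (simp add: ghost_def)
qed

lemma ghosts_precomp:
  assumes "ghosts C k Y Z f" "h \<in> Hom T X Y"
  shows "ghosts C k X Z (f \<cdot> h)"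
proof (cases k)
  case 0
  then show ?thesis using assms Comp_Hom by simp
next
  case (Suc l)
  then obtain V g w where *: "ghost C Y V w" "ghosts C l V Z g" "f = g \<cdot> w"
    using assms by auto
  then have "f \<cdot> h = g \<cdot> (w \<cdot> h)"
    using Comp_assoc[OF assms(2) ghost_Hom ghosts_Hom] by simp
  then show ?thesis using Suc * ghost_precomp[OF *(1) assms(2)] by auto
qed

lemma ghosts_append:
  "ghosts C k Y Z g \<Longrightarrow> ghost C Z W w \<Longrightarrow> ghosts C (Suc k) Y W (w \<cdot> g)"
proof (induction k arbitrary: Y g)
  case 0
  then have "ghost C Y W (w \<cdot> g)" using ghost_precomp by simp
  moreover have "w \<cdot> g = Ident T W \<cdot> (w \<cdot> g)"
    using Ident_Comp[OF ghost_Hom] calculation by simp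
  moreover have "Ident T W \<in> Hom T W W"
    using 0 ghost_Hom Hom_Obj Ident_Hom by blast
  ultimately show ?case by auto
next
  case (Suc k)
  then obtain V h v where *: "ghost C Y V v" "ghosts C k V Z h" "g = h \<cdot> v" by auto
  have "ghosts C (Suc k) V W (w \<cdot> h)" using Suc.IH[OF *(2) Suc.prems(2)] .
  moreover have "w \<cdot> g = (w \<cdot> h) \<cdot> v"
    using Comp_assoc[OF ghost_Hom[OF *(1)] ghosts_Hom[OF *(2)] ghost_Hom[OF Suc.prems(2)]] *(3)
    by simp
  ultimately show ?case using *(1) ghosts.simps(2) by blast
qed

lemma ghosts_Suc_imp: "ghosts C (Suc k) Y Z f \<Longrightarrow> ghosts C k Y Z f"
proof (induction k arbitrary: Y f)
  case 0
  then show ?case using ghosts_Hom[OF 0] by simp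
next
  case (Suc k)
  then obtain V g w where *: "ghost C Y V w" "ghosts C (Suc k) V Z g" "f = g \<cdot> w"
    using ghosts.simps(2)[of C "Suc k" Y Z f] by blast
  then show ?case using Suc.IH[OF *(2)] by auto
qed

lemma ghosts_mono: "ghosts C n Y Z f \<Longrightarrow> k \<le> n \<Longrightarrow> ghosts C k Y Z f"
  by (induction n rule: nat_induct) (metis ghosts_Suc_imp le_Suc_eq le_zero_eq)+

lemma ghost_SuspMor_pow:
  assumes "C \<in> Obj T" "ghost C Y Z w"
  shows "ghost C (Susp_pow T n Y) (Susp_pow T n Z) (SuspMor_pow T n w)"
  unfolding ghost_def
proof (intro conjI ballI)
  note w = ghost_Hom[OF assms(2)]
  note YZ = Hom_Obj[OF w]
  show "SuspMor_pow T n w \<in> Hom T (Susp_pow T n Y) (Susp_pow T n Z)"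
    using SuspMor_pow_Hom[OF w] .
  fix X a assume X: "X \<in> orbit C" and a: "a \<in> Hom T X (Susp_pow T n Y)"
  note X' = orbit_Obj[OF assms(1) X]
  let ?b = "SuspMor_pow T (- n) a"
  have b: "?b \<in> Hom T (Susp_pow T (- n) X) Y"
    using SuspMor_pow_Hom[OF a, of "- n"] YZ by simp
  then have "w \<cdot> ?b = ZeroMor T (Susp_pow T (- n) X) Z"
    using assms(2) orbit_Susp_pow[OF assms(1) X] by (simp add: ghost_def)
  then have "SuspMor_pow T n w \<cdot> SuspMor_pow T n ?b = ZeroMor T X (Susp_pow T n Z)"
    using SuspMor_pow_Comp[OF b w, of n] SuspMor_pow_Zero[OF Susp_pow_Obj[OF X'] YZ(2)] X' by simp
  then show "SuspMor_pow T n w \<cdot> a = ZeroMor T X (Susp_pow T n Z)"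
    using a by simp
qed

lemma ghosts_SuspMor_pow:
  assumes "C \<in> Obj T"
  shows "ghosts C k Y Z f \<Longrightarrow> ghosts C k (Susp_pow T n Y) (Susp_pow T n Z) (SuspMor_pow T n f)"
proof (induction k arbitrary: Y f)
  case 0
  then show ?case using SuspMor_pow_Hom by simp
next
  case (Suc k)
  then obtain V g w where *: "ghost C Y V w" "ghosts C k V Z g" "f = g \<cdot> w" by auto
  then show ?case
    using ghost_SuspMor_pow[OF assms *(1)] Suc.IH[OF *(2)]
      SuspMor_pow_Comp[OF ghost_Hom[OF *(1)] ghosts_Hom[OF *(2)]] by auto
qed

lemma built_from_Obj:
  assumes "C \<in> Obj T"
  shows "B \<in> built_from T C \<Longrightarrow> B \<in> Obj T"
proof (induction rule: built_from.induct)
  case (coproduct X Y P i j)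
  then show ?case by (simp add: is_coproduct_def)
qed (auto simp: assms Susp_pow_Obj is_retract_def is_zero_obj_def)

text \<open>
  A map that vanishes on all suspensions of \<open>C\<close>
  vanishes on all objects of level at most one.
\<close>

lemma ghost_built_from:
  assumes "C \<in> Obj T" "B \<in> built_from T C" "ghost C Y Z w" "a \<in> Hom T B Y"
  shows "w \<cdot> a = ZeroMor T B Z"
  using assms(2-4)
proof (induction arbitrary: Y Z w a)
  case gen
  then show ?case using self_in_orbit by (simp add: ghost_def)
next
  case (susp X n)
  note w = ghost_Hom[OF susp.prems(1)]
  have X: "X \<in> Obj T" using built_from_Obj[OF assms(1) susp.hyps] .
  let ?b = "SuspMor_pow T (- n) a"
  have b: "?b \<in> Hom T X (Susp_pow T (- n) Y)"
    using SuspMor_pow_Hom[OF susp.prems(2), of "- n"] X by simp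
  have "SuspMor_pow T (- n) w \<cdot> ?b = ZeroMor T X (Susp_pow T (- n) Z)"
    using susp.IH[OF ghost_SuspMor_pow[OF assms(1) susp.prems(1)] b] .
  then have "SuspMor_pow T (- n) (w \<cdot> a) = ZeroMor T (Susp_pow T (- n) (Susp_pow T n X)) (Susp_pow T (- n) Z)"
    using SuspMor_pow_Comp[OF susp.prems(2) w] X by simp
  then show ?case using SuspMor_pow_Zero_iff[OF Comp_Hom[OF susp.prems(2) w]] by blast
next
  case (retract V X)
  note w = ghost_Hom[OF retract.prems(1)] and a = retract.prems(2)
  obtain i p where ip: "i \<in> Hom T X V" "p \<in> Hom T V X" "p \<cdot> i = Ident T X"
    using retract.hyps unfolding is_retract_def by blast
  have "w \<cdot> (a \<cdot> p) = ZeroMor T V Z" using retract.IH[OF retract.prems(1) Comp_Hom[OF ip(2) a]] .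
  then have "(w \<cdot> (a \<cdot> p)) \<cdot> i = ZeroMor T X Z"
    using Zero_Comp[OF ip(1) Hom_Obj(2)[OF w]] by simp
  moreover have "(w \<cdot> (a \<cdot> p)) \<cdot> i = w \<cdot> (a \<cdot> (p \<cdot> i))"
    using Comp_assoc[OF ip(1) Comp_Hom[OF ip(2) a] w] Comp_assoc[OF ip(1,2) a] by simp
  ultimately show ?case using ip(3) Comp_Ident[OF a] by simp
next
  case (empty_coproduct O')
  then show ?case using zero_obj_Hom(2) Comp_Hom ghost_Hom by blast
next
  case (coproduct X V P i j)
  note w = ghost_Hom[OF coproduct.prems(1)] and a = coproduct.prems(2)
  have ij: "i \<in> Hom T X P" "j \<in> Hom T V P" and Z: "Z \<in> Obj T" and P: "P \<in> Obj T"
    using coproduct.hyps(3) w Hom_Obj by (auto simp: is_coproduct_def)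
  have "(w \<cdot> a) \<cdot> i = ZeroMor T X Z" "(w \<cdot> a) \<cdot> j = ZeroMor T V Z"
    using coproduct.IH(1)[OF coproduct.prems(1) Comp_Hom[OF ij(1) a]] Comp_assoc[OF ij(1) a w]
      coproduct.IH(2)[OF coproduct.prems(1) Comp_Hom[OF ij(2) a]] Comp_assoc[OF ij(2) a w] by auto
  moreover have "ZeroMor T P Z \<cdot> i = ZeroMor T X Z" "ZeroMor T P Z \<cdot> j = ZeroMor T V Z"
    using Zero_Comp[OF ij(1) Z] Zero_Comp[OF ij(2) Z] by auto
  moreover have "\<exists>!k. k \<in> Hom T P Z \<and> k \<cdot> i = ZeroMor T X Z \<and> k \<cdot> j = ZeroMor T V Z"
    using coproduct.hyps(3) Z Zero_Hom Hom_Obj ij unfolding is_coproduct_def by blast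
  ultimately show ?case using Comp_Hom[OF a w] Zero_Hom[OF P Z] by blast
qed

text \<open>
  The ghost lemma. By induction: the first ghost map vanishes on the level one object \<open>N'\<close> of the
  triangle \<open>N' \<rightarrow> M \<oplus> M~ \<rightarrow> N'' \<rightarrow> \<Sigma>N'\<close>, and so factors through \<open>N''\<close>, where the remaining ones
  compose to zero.
\<close>

lemma ghosts_level:
  assumes "C \<in> Obj T"
  shows "level_is T C k M \<Longrightarrow> ghosts C k M Y f \<Longrightarrow> f = ZeroMor T M Y"
proof (induction k arbitrary: M f)
  case 0
  then show ?case using zero_obj_Hom(2) by simp
next
  case (Suc k)
  obtain V g w where f: "ghost C M V w" "ghosts C k V Y g" "f = g \<cdot> w" using Suc.prems(2) by auto
  note w = ghost_Hom[OF f(1)] and g = ghosts_Hom[OF f(2)]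
  have M: "M \<in> Obj T" and V: "V \<in> Obj T" and Y: "Y \<in> Obj T" using Hom_Obj w g by blast+
  show ?case
  proof (cases "M \<in> built_from T C")
    case True
    have "w = ZeroMor T M V"
      using ghost_built_from[OF assms True f(1) Ident_Hom[OF M]] Comp_Ident[OF w] by simp
    then show ?thesis using f(3) Comp_Zero[OF g M] by simp
  next
    case False
    then obtain N'' where "level_step T C M N''" and N'': "level_is T C k N''"
      using Suc.prems(1) by auto
    then obtain N' Nt P i j a b c where N': "N' \<in> built_from T C"
      and cop: "is_coproduct T M Nt P i j" and tri: "is_exact_triangle T N' P N'' a b c"
      unfolding level_step_def by blast
    note abc = exact_triangle_Hom[OF tri]
    have i: "i \<in> Hom T M P" and Nt: "Nt \<in> Obj T"
      using cop Hom_Obj by (auto simp: is_coproduct_def)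
    obtain p where p: "p \<in> Hom T P M" "p \<cdot> i = Ident T M"
      using coproduct_retract[OF cop Nt] by blast
    have wp: "w \<cdot> p \<in> Hom T P V" using Comp_Hom[OF p(1) w] .
    have "(w \<cdot> p) \<cdot> a = ZeroMor T N' V"
      using ghost_built_from[OF assms N' ghost_precomp[OF f(1) p(1)] abc(1)] .
    then obtain l where l: "l \<in> Hom T N'' V" "l \<cdot> b = w \<cdot> p"
      using exact_triangle_extend[OF tri wp] by blast
    have "g \<cdot> l = ZeroMor T N'' Y" using Suc.IH[OF N'' ghosts_precomp[OF f(2) l(1)]] .
    then have "g \<cdot> (w \<cdot> p) = ZeroMor T P Y"
      using Comp_assoc[OF abc(2) l(1) g] Zero_Comp[OF abc(2) Y] l(2) by simp
    then have "f \<cdot> p = ZeroMor T P Y" using Comp_assoc[OF p(1) w g] f(3) by simp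
    then have "f \<cdot> (p \<cdot> i) = ZeroMor T M Y"
      using Comp_assoc[OF i p(1) ghosts_Hom[OF Suc.prems(2)]] Zero_Comp[OF i Y] by simp
    then show ?thesis using p(2) Comp_Ident[OF ghosts_Hom[OF Suc.prems(2)]] by simp
  qed
qed

end

section \<open>Thick subcategories\<close>

context triangulated_category
begin

text \<open>
  Two out of three follows from the case of the middle term, by rotation.
\<close>

lemma thick_subcategoryI:
  assumes obj: "S \<subseteq> Obj T" and zero: "\<And>Z. is_zero_obj T Z \<Longrightarrow> Z \<in> S"
    and susp: "\<And>n X. X \<in> S \<Longrightarrow> Susp_pow T n X \<in> S"
    and middle: "\<And>X Y Z f g h. is_exact_triangle T X Y Z f g h \<Longrightarrow> X \<in> S \<Longrightarrow> Z \<in> S \<Longrightarrow> Y \<in> S"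
    and retract: "\<And>X Y. is_retract T X Y \<Longrightarrow> Y \<in> S \<Longrightarrow> X \<in> S"
  shows "thick_subcategory T S"
proof -
  have Z: "Z \<in> S" if tri: "is_exact_triangle T X Y Z f g h" and "X \<in> S" "Y \<in> S" for X Y Z f g h
    using middle[OF exact_triangle_rotate[OF tri]] that susp[of X 1] by simp
  have X: "X \<in> S" if tri: "is_exact_triangle T X Y Z f g h" and "Y \<in> S" "Z \<in> S" for X Y Z f g h
  proof -
    have "Susp T X \<in> S" using Z[OF exact_triangle_rotate[OF tri]] that by blast
    then have "Susp_pow T (-1) (Susp_pow T 1 X) \<in> S" using susp[of "Susp T X" "-1"] by simp
    then show ?thesis
      using Susp_pow_cancel(2)[OF Hom_Obj(1)[OF exact_triangle_Hom(1)[OF tri]], of 1] by simp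
  qed
  show ?thesis
    unfolding thick_subcategory_def
    by (intro conjI allI impI ballI obj) (metis zero susp middle retract X Z)+
qed

lemma thick_subset:
  assumes "thick_subcategory T S" "X \<in> S"
  shows "thick T X \<subseteq> S"
  using assms unfolding thick_def by blast

text \<open>The objects \<open>X\<close> with \<open>Hom\<^sup>*(M, X) = 0\<close>.\<close>

lemma thick_Hom_zero:
  assumes M: "M \<in> Obj T"
  shows "thick_subcategory T {X \<in> Obj T. \<forall>n. \<forall>f \<in> Hom T (Susp_pow T n M) X.
    f = ZeroMor T (Susp_pow T n M) X}" (is "thick_subcategory T ?S")
proof (rule thick_subcategoryI)
  have S: "f = ZeroMor T (Susp_pow T n M) X" if "X \<in> ?S" "f \<in> Hom T (Susp_pow T n M) X" for X n f
    using that by blast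
  show "?S \<subseteq> Obj T" by blast
  show "Z \<in> ?S" if "is_zero_obj T Z" for Z
    using that zero_obj_Hom(1) by (auto simp: is_zero_obj_def[of T Z])
  show "Susp_pow T k X \<in> ?S" if X: "X \<in> ?S" for k X
  proof -
    have XO: "X \<in> Obj T" using X by blast
    have "f = ZeroMor T (Susp_pow T n M) (Susp_pow T k X)"
      if f: "f \<in> Hom T (Susp_pow T n M) (Susp_pow T k X)" for n f
    proof -
      have eq: "Susp_pow T (- k) (Susp_pow T n M) = Susp_pow T (n - k) M"
        using Susp_pow_add[OF M, of "- k" n] by simp
      have "SuspMor_pow T (- k) f \<in> Hom T (Susp_pow T (n - k) M) X"
        using SuspMor_pow_Hom[OF f, of "- k"] eq XO by simp
      then have "SuspMor_pow T (- k) f =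
          ZeroMor T (Susp_pow T (- k) (Susp_pow T n M)) (Susp_pow T (- k) (Susp_pow T k X))"
        using S[OF X] eq XO by simp
      then show ?thesis using SuspMor_pow_Zero_iff[OF f] by blast
    qed
    then show ?thesis using Susp_pow_Obj[OF XO] by blast
  qed
  show "Y \<in> ?S" if tri: "is_exact_triangle T X Y Z f g h" and X: "X \<in> ?S" and Z: "Z \<in> ?S"
    for X Y Z f g h
  proof -
    note fgh = exact_triangle_Hom[OF tri]
    have "b = ZeroMor T (Susp_pow T n M) Y" if b: "b \<in> Hom T (Susp_pow T n M) Y" for n b
    proof -
      have "g \<cdot> b = ZeroMor T (Susp_pow T n M) Z" using S[OF Z Comp_Hom[OF b fgh(2)]] .
      then obtain a where a: "a \<in> Hom T (Susp_pow T n M) X" "f \<cdot> a = b"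
        using exact_triangle_lift[OF tri b] by blast
      then show ?thesis using S[OF X a(1)] Comp_Zero[OF fgh(1) Susp_pow_Obj[OF M]] by simp
    qed
    then show ?thesis using Hom_Obj(2)[OF fgh(1)] by blast
  qed
  show "X \<in> ?S" if "is_retract T X Y" and Y: "Y \<in> ?S" for X Y
  proof -
    obtain i p where ip: "i \<in> Hom T X Y" "p \<in> Hom T Y X" "p \<cdot> i = Ident T X" and X: "X \<in> Obj T"
      using \<open>is_retract T X Y\<close> unfolding is_retract_def by blast
    have "b = ZeroMor T (Susp_pow T n M) X" if b: "b \<in> Hom T (Susp_pow T n M) X" for n b
    proof -
      have "p \<cdot> (i \<cdot> b) = ZeroMor T (Susp_pow T n M) X"
        using S[OF Y Comp_Hom[OF b ip(1)]] Comp_Zero[OF ip(2) Susp_pow_Obj[OF M]] by simp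
      then show ?thesis using Comp_assoc[OF b ip(1,2)] ip(3) Ident_Comp[OF b] by simp
    qed
    then show ?thesis using X by blast
  qed
qed

text \<open>Some power of \<open>\<alpha>\<close> vanishes on \<open>X\<close>.\<close>

definition nilpotent_on :: "int \<Rightarrow> ('o \<Rightarrow> 'm) \<Rightarrow> 'o \<Rightarrow> bool" where
  "nilpotent_on d \<alpha> X \<longleftrightarrow> (\<exists>(e, \<beta>) \<in> powers d \<alpha>. \<beta> X = ZeroMor T X (Susp_pow T e X))"

lemma center_Susp_pow_zero:
  assumes "\<beta> \<in> graded_center T e" "X \<in> Obj T" "\<beta> X = ZeroMor T X (Susp_pow T e X)"
  shows "\<beta> (Susp_pow T n X) = ZeroMor T (Susp_pow T n X) (Susp_pow T e (Susp_pow T n X))"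
proof -
  have "SuspMor_pow T n (\<beta> X) = ZeroMor T (Susp_pow T n X) (Susp_pow T e (Susp_pow T n X))"
    using SuspMor_pow_Zero[OF assms(2) Susp_pow_Obj[OF assms(2)]] assms(3)
      Susp_pow_commute[OF assms(2), of n e] by simp
  then show ?thesis
    using up_to_sign_Zero_iff[OF center_Susp_pow[OF assms(1,2)] center_Susp_pow_Hom[OF assms(1,2)]]
    by simp
qed

lemma thick_nilpotent_on:
  assumes \<alpha>: "\<alpha> \<in> graded_center T d"
  shows "thick_subcategory T {X \<in> Obj T. nilpotent_on d \<alpha> X}" (is "thick_subcategory T ?S")
proof (rule thick_subcategoryI)
  show "?S \<subseteq> Obj T" by blast
  show "Z \<in> ?S" if Z: "is_zero_obj T Z" for Z
  proof -
    have ZO: "Z \<in> Obj T" using Z by (simp add: is_zero_obj_def)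
    have "\<alpha> Z = ZeroMor T Z (Susp_pow T d Z)" using zero_obj_Hom(2)[OF Z center_Hom[OF \<alpha> ZO]] .
    then have "nilpotent_on d \<alpha> Z" using powers.base unfolding nilpotent_on_def by fast
    then show ?thesis using ZO by blast
  qed
  show "Susp_pow T n X \<in> ?S" if XS: "X \<in> ?S" for n X
  proof -
    have X: "X \<in> Obj T" using XS by blast
    obtain e \<beta> where \<beta>: "(e, \<beta>) \<in> powers d \<alpha>" "\<beta> X = ZeroMor T X (Susp_pow T e X)"
      using XS unfolding nilpotent_on_def by blast
    have "nilpotent_on d \<alpha> (Susp_pow T n X)"
      using \<beta>(1) center_Susp_pow_zero[OF powers_center[OF \<beta>(1) \<alpha>] X \<beta>(2)]
      unfolding nilpotent_on_def by fast
    then show ?thesis using Susp_pow_Obj[OF X] by blast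
  qed
  show "Y \<in> ?S" if tri: "is_exact_triangle T X Y Z f g h" and X: "X \<in> ?S" and Z: "Z \<in> ?S"
    for X Y Z f g h
  proof -
    note fgh = exact_triangle_Hom[OF tri]
    have XO: "X \<in> Obj T" and YO: "Y \<in> Obj T" and ZO: "Z \<in> Obj T" using fgh Hom_Obj by blast+
    obtain m \<beta> where \<beta>: "(m, \<beta>) \<in> powers d \<alpha>" "\<beta> Z = ZeroMor T Z (Susp_pow T m Z)"
      using Z unfolding nilpotent_on_def by blast
    obtain n \<gamma> where \<gamma>: "(n, \<gamma>) \<in> powers d \<alpha>" "\<gamma> X = ZeroMor T X (Susp_pow T n X)"
      using X unfolding nilpotent_on_def by blast
    note \<beta>c = powers_center[OF \<beta>(1) \<alpha>] and \<gamma>c = powers_center[OF \<gamma>(1) \<alpha>]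
    note \<beta>Y = center_Hom[OF \<beta>c YO] and \<gamma>Y = center_Hom[OF \<gamma>c YO]
    \<comment> \<open>Composed with \<open>\<Sigma>\<^sup>m g\<close>, the morphism \<open>\<beta>\<^sub>Y\<close> vanishes; so it factors through \<open>\<Sigma>\<^sup>m X\<close>, where \<open>\<gamma>\<close> is zero.\<close>
    let ?b = "SuspMor_pow T (- m) (\<beta> Y)"
    have b: "?b \<in> Hom T (Susp_pow T (- m) Y) Y"
      using SuspMor_pow_Hom[OF \<beta>Y, of "- m"] YO by simp
    have "SuspMor_pow T m g \<cdot> \<beta> Y = ZeroMor T Y (Susp_pow T m Z)"
      using center_natural[OF \<beta>c fgh(2)] \<beta>(2) Zero_Comp[OF fgh(2) Susp_pow_Obj[OF ZO]] by simp
    then have "SuspMor_pow T m (g \<cdot> ?b) =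
        ZeroMor T (Susp_pow T m (Susp_pow T (- m) Y)) (Susp_pow T m Z)"
      using SuspMor_pow_Comp[OF b fgh(2)] \<beta>Y YO by simp
    then have "g \<cdot> ?b = ZeroMor T (Susp_pow T (- m) Y) Z"
      using SuspMor_pow_Zero_iff[OF Comp_Hom[OF b fgh(2)]] by blast
    then obtain a where a: "a \<in> Hom T (Susp_pow T (- m) Y) X" "f \<cdot> a = ?b"
      using exact_triangle_lift[OF tri b] by blast
    have "\<gamma> Y \<cdot> f = ZeroMor T X (Susp_pow T n Y)"
      using center_natural[OF \<gamma>c fgh(1)] \<gamma>(2) Comp_Zero[OF SuspMor_pow_Hom[OF fgh(1)] XO] by simp
    then have \<gamma>b: "\<gamma> Y \<cdot> ?b = ZeroMor T (Susp_pow T (- m) Y) (Susp_pow T n Y)"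
      using Comp_assoc[OF a(1) fgh(1) \<gamma>Y] a(2) Zero_Comp[OF a(1) Susp_pow_Obj[OF YO]] by simp
    have "SuspMor_pow T m (\<gamma> Y) \<cdot> \<beta> Y = SuspMor_pow T m (\<gamma> Y \<cdot> ?b)"
      using SuspMor_pow_Comp[OF b \<gamma>Y] \<beta>Y by simp
    also have "\<dots> = ZeroMor T Y (Susp_pow T m (Susp_pow T n Y))"
      using \<gamma>b SuspMor_pow_Zero[OF Susp_pow_Obj[OF YO] Susp_pow_Obj[OF YO]] YO by simp
    also have "Susp_pow T m (Susp_pow T n Y) = Susp_pow T (n + m) Y"
      using Susp_pow_add[OF YO, of m n] by (simp add: add.commute)
    finally have z: "SuspMor_pow T m (\<gamma> Y) \<cdot> \<beta> Y = ZeroMor T Y (Susp_pow T (n + m) Y)" .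
    have "SuspMor_pow T m (\<gamma> Y) \<in> Hom T (Susp_pow T m Y) (Susp_pow T (n + m) Y)"
      using center_Susp_pow_Hom[OF \<gamma>c YO, of m] Susp_pow_add[OF YO, of n m] by simp
    then have "\<gamma> (Susp_pow T m Y) \<cdot> \<beta> Y = ZeroMor T Y (Susp_pow T (n + m) Y)"
      using up_to_sign_Zero_iff[OF up_to_sign_Comp_right[OF center_Susp_pow[OF \<gamma>c YO] \<beta>Y]
          Comp_Hom[OF \<beta>Y]] z by blast
    then have "nilpotent_on d \<alpha> Y"
      using powers.mult[OF \<gamma>(1) \<beta>(1)] unfolding nilpotent_on_def by fast
    then show ?thesis using YO by blast
  qed
  show "X \<in> ?S" if "is_retract T X Y" and Y: "Y \<in> ?S" for X Y
  proof -
    obtain i p where ip: "i \<in> Hom T X Y" "p \<in> Hom T Y X" "p \<cdot> i = Ident T X" and X: "X \<in> Obj T"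
      using \<open>is_retract T X Y\<close> unfolding is_retract_def by blast
    obtain e \<beta> where \<beta>: "(e, \<beta>) \<in> powers d \<alpha>" "\<beta> Y = ZeroMor T Y (Susp_pow T e Y)"
      using Y unfolding nilpotent_on_def by blast
    note \<beta>c = powers_center[OF \<beta>(1) \<alpha>]
    have "\<beta> X \<cdot> p = ZeroMor T Y (Susp_pow T e X)"
      using center_natural[OF \<beta>c ip(2)] \<beta>(2) Comp_Zero[OF SuspMor_pow_Hom[OF ip(2)] Hom_Obj(1)[OF ip(2)]]
      by simp
    then have "\<beta> X = ZeroMor T X (Susp_pow T e X)"
      using Comp_assoc[OF ip(1,2) center_Hom[OF \<beta>c X]] ip(3) Comp_Ident[OF center_Hom[OF \<beta>c X]]
        Zero_Comp[OF ip(1) Susp_pow_Obj[OF X]] by simp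
    then have "nilpotent_on d \<alpha> X" using \<beta>(1) unfolding nilpotent_on_def by fast
    then show ?thesis using X by blast
  qed
qed

end

section \<open>Koszul objects\<close>

context triangulated_category
begin

text \<open>The triangle in the next lemmas exhibits \<open>L\<close> as \<open>N//\<alpha>\<close>.\<close>

lemma koszul_zero:
  assumes "is_exact_triangle T N (Susp_pow T d N) L (\<alpha> N) q w"
  shows "SuspMor T (\<alpha> N) \<cdot> w = ZeroMor T L (Susp_pow T (d + 1) N)"
proof -
  note tri = exact_triangle_Hom[OF assms]
  have N: "N \<in> Obj T" using tri Hom_Obj by blast
  note S = SuspMor_Hom[OF tri(1)]
  have "NegMor T (SuspMor T (\<alpha> N)) \<cdot> w = ZeroMor T L (Susp T (Susp_pow T d N))"
    using exact_triangle_comp_zero[OF exact_triangle_rotate[OF exact_triangle_rotate[OF assms]]]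
    by simp
  then show ?thesis
    using Neg_Comp[OF tri(3) S] Neg_eq_Zero_iff[OF Comp_Hom[OF tri(3) S]] Susp_pow_Suc[OF N] by simp
qed

text \<open>Multiplication by \<open>\<alpha>\<close> on \<open>N//\<alpha>\<close> need not vanish, but its square does.\<close>

lemma koszul_nilpotent:
  assumes \<alpha>: "\<alpha> \<in> graded_center T d"
    and tri: "is_exact_triangle T N (Susp_pow T d N) L (\<alpha> N) q w"
  shows "nilpotent_on d \<alpha> L"
proof -
  note H = exact_triangle_Hom[OF tri]
  have N: "N \<in> Obj T" and L: "L \<in> Obj T" using H Hom_Obj by blast+
  note \<alpha>L = center_Hom[OF \<alpha> L]
  have "SuspMor_pow T d q \<cdot> SuspMor_pow T d (\<alpha> N) = ZeroMor T (Susp_pow T d N) (Susp_pow T d L)"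
    using SuspMor_pow_Comp[OF H(1,2)] exact_triangle_comp_zero[OF tri] SuspMor_pow_Zero[OF N L] by simp
  then have "SuspMor_pow T d q \<cdot> \<alpha> (Susp_pow T d N) = ZeroMor T (Susp_pow T d N) (Susp_pow T d L)"
    using up_to_sign_Zero_iff[OF up_to_sign_Comp_left[OF center_Susp_pow[OF \<alpha> N]
          center_Susp_pow_Hom[OF \<alpha> N] SuspMor_pow_Hom[OF H(2)]]
        Comp_Hom[OF center_Susp_pow_Hom[OF \<alpha> N] SuspMor_pow_Hom[OF H(2)]]] by blast
  then have "\<alpha> L \<cdot> q = ZeroMor T (Susp_pow T d N) (Susp_pow T d L)"
    using center_natural[OF \<alpha> H(2)] by simp
  then obtain h where h: "h \<in> Hom T (Susp T N) (Susp_pow T d L)" "h \<cdot> w = \<alpha> L"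
    using exact_triangle_extend[OF exact_triangle_rotate[OF tri] \<alpha>L] by blast
  have SN: "Susp T N \<in> Obj T" using Susp_Obj[OF N] .
  have c: "Susp_pow T (d + 1) N = Susp_pow T d (Susp T N)"
    using Susp_pow_add[OF N, of d 1] by simp
  have s: "up_to_sign (\<alpha> (Susp T N)) (SuspMor T (\<alpha> N))"
    using center_Susp_pow[OF \<alpha> N, of 1] by simp
  have sH: "SuspMor T (\<alpha> N) \<in> Hom T (Susp T N) (Susp_pow T d (Susp T N))"
    using center_Susp_pow_Hom[OF \<alpha> N, of 1] by simp
  have "\<alpha> (Susp T N) \<cdot> w = ZeroMor T L (Susp_pow T d (Susp T N))"
    using up_to_sign_Zero_iff[OF up_to_sign_Comp_right[OF s H(3) sH] Comp_Hom[OF H(3) sH]]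
      koszul_zero[where \<alpha> = \<alpha>, OF tri] c by simp
  then have "SuspMor_pow T d h \<cdot> (\<alpha> (Susp T N) \<cdot> w) = ZeroMor T L (Susp_pow T d (Susp_pow T d L))"
    using Comp_Zero[OF SuspMor_pow_Hom[OF h(1)] L] by simp
  then have "\<alpha> (Susp_pow T d L) \<cdot> \<alpha> L = ZeroMor T L (Susp_pow T d (Susp_pow T d L))"
    using Comp_assoc[OF H(3) center_Hom[OF \<alpha> SN] SuspMor_pow_Hom[OF h(1)]]
      Comp_assoc[OF H(3) h(1) center_Hom[OF \<alpha> Susp_pow_Obj[OF L]]]
      center_natural[OF \<alpha> h(1)] h(2) by simp
  then have "\<alpha> (Susp_pow T d L) \<cdot> \<alpha> L = ZeroMor T L (Susp_pow T (d + d) L)"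
    unfolding Susp_pow_add[OF L] .
  then show ?thesis
    using powers.mult[OF powers.base powers.base, of d \<alpha>] unfolding nilpotent_on_def by fast
qed

text \<open>
  The action of the center on \<open>Hom\<^sup>*(C, N)\<close> through \<open>N\<close> agrees with the action through \<open>C\<close> up to
  sign and suspension.
\<close>

lemma center_left_right:
  assumes \<alpha>: "\<alpha> \<in> graded_center T d" and Y: "Y \<in> Obj T" and a: "a \<in> Hom T (Susp_pow T d Y) N"
  shows "up_to_sign (\<alpha> N \<cdot> a) (SuspMor_pow T d (a \<cdot> \<alpha> Y))"
  using center_natural[OF \<alpha> a] SuspMor_pow_Comp[OF center_Hom[OF \<alpha> Y] a]
    up_to_sign_Comp_left[OF center_Susp_pow[OF \<alpha> Y] center_Susp_pow_Hom[OF \<alpha> Y] SuspMor_pow_Hom[OF a]]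
  by simp

lemma center_left_right_zero:
  assumes \<alpha>: "\<alpha> \<in> graded_center T d" and Y: "Y \<in> Obj T" and a: "a \<in> Hom T (Susp_pow T d Y) N"
  shows "\<alpha> N \<cdot> a = ZeroMor T (Susp_pow T d Y) (Susp_pow T d N) \<longleftrightarrow> a \<cdot> \<alpha> Y = ZeroMor T Y N"
  using up_to_sign_Zero_iff[OF center_left_right[OF assms]]
    SuspMor_pow_Hom[OF Comp_Hom[OF center_Hom[OF \<alpha> Y] a]]
    SuspMor_pow_Zero_iff[OF Comp_Hom[OF center_Hom[OF \<alpha> Y] a]] by blast

lemma non_zero_divisor_left:
  assumes C: "C \<in> Obj T" and \<alpha>: "\<alpha> \<in> graded_center T d"
  shows "non_zero_divisor_mod C N (zero_submodule C N) d \<alpha> \<longleftrightarrow>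
    (\<forall>X \<in> orbit C. \<forall>a \<in> Hom T X N. \<alpha> N \<cdot> a = ZeroMor T X (Susp_pow T d N) \<longrightarrow> a = ZeroMor T X N)"
    (is "_ \<longleftrightarrow> ?R")
proof
  assume nzd: "non_zero_divisor_mod C N (zero_submodule C N) d \<alpha>"
  show ?R
  proof (intro ballI impI)
    fix X a assume X: "X \<in> orbit C" and a: "a \<in> Hom T X N"
      and z: "\<alpha> N \<cdot> a = ZeroMor T X (Susp_pow T d N)"
    let ?Y = "Susp_pow T (- d) X"
    have Y: "?Y \<in> orbit C" "Susp_pow T d ?Y = X"
      using orbit_Susp_pow[OF C X] orbit_Obj[OF C X] by simp_all
    have a': "a \<in> Hom T (Susp_pow T d ?Y) N" using a Y by simp
    have "a \<cdot> \<alpha> ?Y = ZeroMor T ?Y N"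
      using center_left_right_zero[OF \<alpha> orbit_Obj[OF C Y(1)] a'] z Y(2) by simp
    then have "a \<cdot> \<alpha> ?Y \<in> zero_submodule C N" using Y(1) by (simp add: zero_submodule_def)
    then have "a \<in> zero_submodule C N" using nzd Y(1) a' unfolding non_zero_divisor_mod_def by blast
    then show "a = ZeroMor T X N" using zero_submodule_iff[OF C X a] by blast
  qed
next
  assume R: ?R
  show "non_zero_divisor_mod C N (zero_submodule C N) d \<alpha>"
    unfolding non_zero_divisor_mod_def
  proof (intro ballI impI)
    fix Y a assume Y: "Y \<in> orbit C" and a: "a \<in> Hom T (Susp_pow T d Y) N"
      and "a \<cdot> \<alpha> Y \<in> zero_submodule C N"
    then have "a \<cdot> \<alpha> Y = ZeroMor T Y N"
      using zero_submodule_iff[OF C Y Comp_Hom[OF center_Hom[OF \<alpha> orbit_Obj[OF C Y]] a]] by blast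
    then have "a = ZeroMor T (Susp_pow T d Y) N"
      using center_left_right_zero[OF \<alpha> orbit_Obj[OF C Y] a] R orbit_Susp_pow[OF C Y] a by blast
    then show "a \<in> zero_submodule C N"
      using zero_submodule_iff[OF C orbit_Susp_pow[OF C Y] a] by blast
  qed
qed

lemma koszul_ghost:
  assumes C: "C \<in> Obj T" and \<alpha>: "\<alpha> \<in> graded_center T d"
    and tri: "is_exact_triangle T N (Susp_pow T d N) L (\<alpha> N) q w"
    and nzd: "non_zero_divisor_mod C N (zero_submodule C N) d \<alpha>"
  shows "ghost C L (Susp T N) w"
  unfolding ghost_def
proof (intro conjI ballI)
  note H = exact_triangle_Hom[OF tri]
  have N: "N \<in> Obj T" using H Hom_Obj by blast
  show "w \<in> Hom T L (Susp T N)" by (rule H)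
  fix X b assume X: "X \<in> orbit C" and b: "b \<in> Hom T X L"
  note X' = orbit_Obj[OF C X]
  note wb = Comp_Hom[OF b H(3)]
  let ?Y = "Susp_pow T (- 1) X" and ?c = "SuspMor_pow T (- 1) (w \<cdot> b)"
  have Y: "?Y \<in> orbit C" using orbit_Susp_pow[OF C X] .
  have c: "?c \<in> Hom T ?Y N"
    using SuspMor_pow_Hom[OF wb, of "- 1"] Susp_pow_cancel(2)[OF N, of 1] by simp
  have Sc: "SuspMor T ?c = w \<cdot> b" using SuspMor_pow_cancel(1)[OF wb, of 1] by simp
  have "SuspMor T (\<alpha> N) \<cdot> (w \<cdot> b) = ZeroMor T X (Susp_pow T (d + 1) N)"
    using Comp_assoc[OF b H(3) SuspMor_Hom[OF H(1)]] koszul_zero[where \<alpha> = \<alpha>, OF tri]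
      Zero_Comp[OF b Susp_pow_Obj[OF N]] by simp
  then have "SuspMor_pow T 1 (\<alpha> N \<cdot> ?c) =
      ZeroMor T (Susp_pow T 1 ?Y) (Susp_pow T 1 (Susp_pow T d N))"
    using SuspMor_pow_Comp[OF c H(1), of 1] Sc Susp_pow_cancel(1)[OF X', of 1] Susp_pow_Suc[OF N]
    by simp
  then have "\<alpha> N \<cdot> ?c = ZeroMor T ?Y (Susp_pow T d N)"
    using SuspMor_pow_Zero_iff[OF Comp_Hom[OF c H(1)]] by blast
  then have "?c = ZeroMor T ?Y N" using nzd non_zero_divisor_left[OF C \<alpha>] Y c by blast
  then show "w \<cdot> b = ZeroMor T X (Susp T N)"
    using Sc SuspMor_pow_Zero[OF orbit_Obj[OF C Y] N, of 1] Susp_pow_cancel(1)[OF X', of 1] by simp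
qed

text \<open>
  If \<open>\<alpha>\<close> is a non-zero divisor, then \<open>Hom\<^sup>*(C, N//\<alpha>)\<close> is a shift of
  \<open>Hom\<^sup>*(C, N) / \<alpha> Hom\<^sup>*(C, N)\<close>.
\<close>

lemma weakly_regular_koszul_step:
  assumes C: "C \<in> Obj T" and \<alpha>: "\<alpha> \<in> graded_center T d"
    and tri: "is_exact_triangle T N (Susp_pow T d N) L (\<alpha> N) q w"
    and nzd: "non_zero_divisor_mod C N (zero_submodule C N) d \<alpha>"
    and zs: "\<forall>(e, \<beta>) \<in> set zs. \<beta> \<in> graded_center T e"
  shows "weakly_regular C L (zero_submodule C L) zs \<longleftrightarrow>
    weakly_regular C N (adjoin C N (zero_submodule C N) d \<alpha>) zs"
proof -
  note H = exact_triangle_Hom[OF tri]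
  have N: "N \<in> Obj T" and L: "L \<in> Obj T" using H Hom_Obj by blast+
  note zN = submodule_zero_submodule[OF C N] and zL = submodule_zero_submodule[OF C L]
  show ?thesis
  proof (rule weakly_regular_transport[OF C N H(2) _ zs submodule_adjoin[OF C N zN \<alpha>] zL])
    fix X b assume X: "X \<in> orbit C" and b: "b \<in> Hom T (Susp_pow T d X) L"
    have "w \<cdot> b = ZeroMor T (Susp_pow T d X) (Susp T N)"
      using koszul_ghost[OF C \<alpha> tri nzd] orbit_Susp_pow[OF C X] b unfolding ghost_def by blast
    then obtain a where a: "a \<in> Hom T (Susp_pow T d X) (Susp_pow T d N)" "q \<cdot> a = b"
      using exact_triangle_lift[OF exact_triangle_rotate[OF tri] b] by blast
    have "SuspMor_pow T (- d) a \<in> Hom T X N"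
      using SuspMor_pow_Hom[OF a(1), of "- d"] N orbit_Obj[OF C X] by simp
    then show "\<exists>a \<in> Hom T X N. q \<cdot> SuspMor_pow T d a = b" using a SuspMor_pow_cancel(1)[OF a(1)] by metis
  next
    fix X a assume X: "X \<in> orbit C" and a: "a \<in> Hom T X N"
    note X' = orbit_Obj[OF C X]
    note Sa = SuspMor_pow_Hom[OF a, of d]
    have \<alpha>X: "\<alpha> X \<in> Hom T X (Susp_pow T d X)" using center_Hom[OF \<alpha> X'] .
    have "q \<cdot> SuspMor_pow T d a \<in> zero_submodule C L \<longleftrightarrow>
        q \<cdot> SuspMor_pow T d a = ZeroMor T (Susp_pow T d X) L"
      using zero_submodule_iff[OF C orbit_Susp_pow[OF C X] Comp_Hom[OF Sa H(2)]] .
    also have "\<dots> \<longleftrightarrow> (\<exists>b \<in> Hom T (Susp_pow T d X) N. \<alpha> N \<cdot> b = SuspMor_pow T d a)"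
    proof
      assume "\<exists>b \<in> Hom T (Susp_pow T d X) N. \<alpha> N \<cdot> b = SuspMor_pow T d a"
      then obtain b where b: "b \<in> Hom T (Susp_pow T d X) N" "\<alpha> N \<cdot> b = SuspMor_pow T d a" by blast
      then show "q \<cdot> SuspMor_pow T d a = ZeroMor T (Susp_pow T d X) L"
        using Comp_assoc[OF b(1) H(1,2)] exact_triangle_comp_zero[OF tri] Zero_Comp[OF b(1) L] by simp
    qed (use exact_triangle_lift[OF tri Sa] in blast)
    also have "\<dots> \<longleftrightarrow> (\<exists>b \<in> Hom T (Susp_pow T d X) N. a = b \<cdot> \<alpha> X)"
    proof -
      have key: "\<exists>c \<in> Hom T (Susp_pow T d X) N. \<alpha> N \<cdot> c = SuspMor_pow T d (b \<cdot> \<alpha> X)"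
        and key': "\<exists>c \<in> Hom T (Susp_pow T d X) N. \<alpha> N \<cdot> b = SuspMor_pow T d (c \<cdot> \<alpha> X)"
        if b: "b \<in> Hom T (Susp_pow T d X) N" for b
      proof -
        have b\<alpha>: "b \<cdot> \<alpha> X \<in> Hom T X N" using Comp_Hom[OF \<alpha>X b] .
        note Sb = SuspMor_pow_Hom[OF b\<alpha>, of d]
        have "\<alpha> N \<cdot> NegMor T b = NegMor T (\<alpha> N \<cdot> b)" using Comp_Neg[OF b H(1)] .
        moreover have "SuspMor_pow T d (NegMor T b \<cdot> \<alpha> X) = NegMor T (SuspMor_pow T d (b \<cdot> \<alpha> X))"
          using Neg_Comp[OF \<alpha>X b] SuspMor_pow_Neg[OF b\<alpha>] by simp
        ultimately show "\<exists>c \<in> Hom T (Susp_pow T d X) N. \<alpha> N \<cdot> c = SuspMor_pow T d (b \<cdot> \<alpha> X)"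
          "\<exists>c \<in> Hom T (Susp_pow T d X) N. \<alpha> N \<cdot> b = SuspMor_pow T d (c \<cdot> \<alpha> X)"
          using center_left_right[OF \<alpha> X' b] b Neg_Hom[OF b] Neg_Neg[OF Sb]
          unfolding up_to_sign_def by metis+
      qed
      show ?thesis
        using key key' SuspMor_pow_eq_iff[OF a Comp_Hom[OF \<alpha>X]] by metis
    qed
    also have "\<dots> \<longleftrightarrow> a \<in> adjoin C N (zero_submodule C N) d \<alpha>"
      using adjoin_zero_iff[OF C X a \<alpha>] by blast
    finally show "q \<cdot> SuspMor_pow T d a \<in> zero_submodule C L \<longleftrightarrow>
      a \<in> adjoin C N (zero_submodule C N) d \<alpha>" .
  qed
qed

text \<open>
  Regularity stated on the objects of a Koszul tower is weak regularity on \<open>Hom\<^sup>*(C, K 0)\<close>.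
\<close>

lemma weakly_regular_koszul:
  assumes "C \<in> Obj T"
    and "\<And>s d \<alpha>. s < length zs \<Longrightarrow> zs ! s = (d, \<alpha>) \<Longrightarrow> \<alpha> \<in> graded_center T d \<and>
      is_exact_triangle T (K s) (Susp_pow T d (K s)) (K (Suc s)) (\<alpha> (K s)) (q s) (w s) \<and>
      non_zero_divisor_mod C (K s) (zero_submodule C (K s)) d \<alpha>"
  shows "weakly_regular C (K 0) (zero_submodule C (K 0)) zs"
  using assms(2)
proof (induction zs arbitrary: K q w)
  case Nil
  show ?case by simp
next
  case (Cons z zs)
  obtain d \<alpha> where z: "z = (d, \<alpha>)" by force
  have "weakly_regular C (K (Suc 0)) (zero_submodule C (K (Suc 0))) zs"
    using Cons.prems[of "Suc s" for s] by (intro Cons.IH[of "\<lambda>s. K (Suc s)" "\<lambda>s. q (Suc s)" "\<lambda>s. w (Suc s)"]) auto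
  moreover have "\<forall>(e, \<beta>) \<in> set zs. \<beta> \<in> graded_center T e"
    using Cons.prems[of "Suc s" for s] by (fastforce simp: in_set_conv_nth)
  ultimately show ?case
    using Cons.prems[of 0 d \<alpha>] z weakly_regular_koszul_step[OF assms(1), of \<alpha> d "K 0" "K (Suc 0)"] by auto
qed

text \<open>
  Let \<open>\<alpha>\<close> be the first entry of the sequence. A power \<open>\<beta>\<close> of \<open>\<alpha>\<close> vanishes on \<open>M\<close> and so kills \<open>f\<close>; hence
  \<open>\<Sigma>f\<close> factors through the ghost map \<open>N//\<beta> \<rightarrow> \<Sigma>N\<close>; the rest of the sequence is weakly regular on
  \<open>N//\<beta>\<close>, so that this can be iterated.
\<close>

lemma nilpotent_imp_ghosts:
  assumes "C \<in> Obj T"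
    and "\<forall>(d, \<alpha>) \<in> set zs. \<alpha> \<in> graded_center T d"
    and "weakly_regular C N (zero_submodule C N) zs"
    and "\<forall>(d, \<alpha>) \<in> set zs. nilpotent_on d \<alpha> M"
    and "f \<in> Hom T M N"
  shows "ghosts C (length zs) M N f"
  using assms(2-)
proof (induction zs arbitrary: N M f)
  case Nil
  then show ?case by simp
next
  case (Cons z zs)
  note C = assms(1) and f = Cons.prems(4)
  have M: "M \<in> Obj T" and N: "N \<in> Obj T" using f Hom_Obj by blast+
  obtain d \<alpha> where z: "z = (d, \<alpha>)" by force
  have \<alpha>: "\<alpha> \<in> graded_center T d" and zs: "\<forall>(d, \<alpha>) \<in> set zs. \<alpha> \<in> graded_center T d"
    and nil: "nilpotent_on d \<alpha> M" "\<forall>(d, \<alpha>) \<in> set zs. nilpotent_on d \<alpha> M"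
    using Cons.prems(1,3) z by auto
  obtain e \<beta> where \<beta>: "(e, \<beta>) \<in> powers d \<alpha>" "\<beta> M = ZeroMor T M (Susp_pow T e M)"
    using nil(1) unfolding nilpotent_on_def by blast
  note \<beta>c = powers_center[OF \<beta>(1) \<alpha>]
  have reg: "weakly_regular C N (zero_submodule C N) ((e, \<beta>) # zs)"
    using weakly_regular_powers[OF \<beta>(1) C N \<alpha> zs] Cons.prems(2) z by blast
  then have nzd: "non_zero_divisor_mod C N (zero_submodule C N) e \<beta>" by simp
  obtain L q w where tri: "is_exact_triangle T N (Susp_pow T e N) L (\<beta> N) q w"
    using TR1_cone[OF center_Hom[OF \<beta>c N]] by blast
  note H = exact_triangle_Hom[OF tri]
  have "\<beta> N \<cdot> f = ZeroMor T M (Susp_pow T e N)"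
    using center_natural[OF \<beta>c f] \<beta>(2) Comp_Zero[OF SuspMor_pow_Hom[OF f] M] by simp
  then have "SuspMor T (\<beta> N) \<cdot> SuspMor T f = ZeroMor T (Susp T M) (Susp T (Susp_pow T e N))"
    using SuspMor_Comp[OF f H(1)] SuspMor_pow_Zero[OF M Susp_pow_Obj[OF N], of 1] by simp
  then have "NegMor T (SuspMor T (\<beta> N)) \<cdot> SuspMor T f =
      ZeroMor T (Susp T M) (Susp T (Susp_pow T e N))"
    using Neg_Comp[OF SuspMor_Hom[OF f] SuspMor_Hom[OF H(1)]]
      Neg_Zero Susp_Obj[OF M] Susp_Obj[OF Susp_pow_Obj[OF N]] by simp
  then obtain g where g: "g \<in> Hom T (Susp T M) L" "w \<cdot> g = SuspMor T f"
    using exact_triangle_lift[OF exact_triangle_rotate[OF exact_triangle_rotate[OF tri]]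
        SuspMor_Hom[OF f]] by blast
  have "ghosts C (length zs) (Susp T M) L g"
  proof (rule Cons.IH[OF zs _ _ g(1)])
    show "weakly_regular C L (zero_submodule C L) zs"
      using weakly_regular_koszul_step[OF C \<beta>c tri nzd zs] reg by simp
    show "\<forall>(d, \<alpha>) \<in> set zs. nilpotent_on d \<alpha> (Susp T M)"
    proof safe
      fix d \<alpha> assume "(d, \<alpha>) \<in> set zs"
      then have "thick_subcategory T {X \<in> Obj T. nilpotent_on d \<alpha> X}" "nilpotent_on d \<alpha> M"
        using zs nil(2) thick_nilpotent_on by auto
      then have "Susp_pow T 1 M \<in> {X \<in> Obj T. nilpotent_on d \<alpha> X}"
        using M unfolding thick_subcategory_def by blast
      then show "nilpotent_on d \<alpha> (Susp T M)" by simp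
    qed
  qed
  then have "ghosts C (Suc (length zs)) (Susp T M) (Susp T N) (SuspMor T f)"
    using ghosts_append[OF _ koszul_ghost[OF C \<beta>c tri nzd]] g(2) by metis
  then show ?case
    using ghosts_SuspMor_pow[OF C, of _ "Susp T M" "Susp T N" "SuspMor T f" "-1"]
      Susp_pow_cancel(2)[OF M, of 1] Susp_pow_cancel(2)[OF N, of 1] SuspMor_pow_cancel(2)[OF f, of 1]
    by (simp del: ghosts.simps)
qed

end

section \<open>The lower bound for levels\<close>

theorem theoremB:
  fixes T :: "('o, 'm, 'x) triangulated_category_scheme"
    and R :: "('r, 'y) ring_scheme"
    and G :: "int \<Rightarrow> 'r set"
    and \<phi> :: "int \<Rightarrow> 'r \<Rightarrow> 'o \<Rightarrow> 'm"
    and xs :: "(int \<times> 'r) list"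
    and K :: "nat \<Rightarrow> 'o" and q w :: "nat \<Rightarrow> 'm"
    and C M :: 'o
  assumes "linear_triangulated_category T R G \<phi>"
    and "C \<in> Obj T" and "M \<in> Obj T"
    and "\<forall>(d, x) \<in> set xs. x \<in> G d"
    and "koszul_tower T \<phi> C xs K q w"
    and "regular_sequence T \<phi> C xs K w"
    and "M \<in> thick T (K (length xs))"
    and "\<not> is_zero_obj T M"
  shows "level T C M \<ge> enat (length xs + 1)"
proof -
  interpret linear_triangulated_category T R G \<phi> by fact
  note C = assms(2) and M = assms(3)
  let ?t = "length xs"
  define zs where "zs = map (\<lambda>(d, x). (d, \<phi> d x)) xs"
  have K0: "K 0 = C" using assms(5) by (simp add: koszul_tower_def)
  have tower: "\<phi> d x \<in> graded_center T d"
    "is_exact_triangle T (K s) (Susp_pow T d (K s)) (K (Suc s)) (\<phi> d x (K s)) (q s) (w s)"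
    "non_zero_divisor_on_Hom T \<phi> d x C (K s)"
    if "s < ?t" "xs ! s = (d, x)" for s d x
  proof -
    have "x \<in> G d" using assms(4) that nth_mem[of s xs] by auto
    then show "\<phi> d x \<in> graded_center T d" by (rule \<phi>_center)
    show "is_exact_triangle T (K s) (Susp_pow T d (K s)) (K (Suc s)) (\<phi> d x (K s)) (q s) (w s)"
      using assms(5) that unfolding koszul_tower_def by fastforce
    show "non_zero_divisor_on_Hom T \<phi> d x C (K s)"
      using assms(6) that unfolding regular_sequence_def by fastforce
  qed
  have nzd: "non_zero_divisor_mod C (K s) (zero_submodule C (K s)) d (\<phi> d x)"
    if s: "s < ?t" "xs ! s = (d, x)" for s d x
    unfolding non_zero_divisor_left[OF C tower(1)[OF s]]
  proof (intro ballI impI)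
    note \<phi>K = exact_triangle_Hom(1)[OF tower(2)[OF s]]
    have Ks: "K s \<in> Obj T" using \<phi>K Hom_Obj by blast
    fix X a assume "X \<in> orbit C" and a: "a \<in> Hom T X (K s)"
      and z: "\<phi> d x (K s) \<cdot>\<^bsub>T\<^esub> a = ZeroMor T X (Susp_pow T d (K s))"
    then obtain n where X: "X = Susp_pow T n C" by (auto simp: orbit_def)
    then have XO: "X \<in> Obj T" using Susp_pow_Obj C by simp
    let ?a = "SuspMor_pow T (- n) a" and ?o = "ZeroMor T C (Susp_pow T (- n) (K s))"
    have XC: "Susp_pow T (- n) X = C" using X C by simp
    have a': "?a \<in> Hom T C (Susp_pow T (- n) (K s))"
      using SuspMor_pow_Hom[OF a, of "- n"] XC by simp
    have o: "?o \<in> Hom T C (Susp_pow T (- n) (K s))" using Zero_Hom C Susp_pow_Obj[OF Ks] by blast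
    have "graded_act T \<phi> d x (K s) (- n) ?a = graded_act T \<phi> d x (K s) (- n) ?o"
      using SuspMor_pow_Comp[OF a \<phi>K, of "- n"] z SuspMor_pow_Zero[OF XO Susp_pow_Obj[OF Ks], of "- n"] XC
        Comp_Zero[OF SuspMor_pow_Hom[OF \<phi>K] C, of "- n"] by (simp add: graded_act_def)
    then have "?a = ?o"
      using tower(3)[OF s] a' o unfolding non_zero_divisor_on_Hom_def by (meson inj_onD)
    then show "a = ZeroMor T X (K s)" using SuspMor_pow_Zero_iff[OF a, of "- n"] XC by simp
  qed
  have zs_center: "\<forall>(d, \<alpha>) \<in> set zs. \<alpha> \<in> graded_center T d"
    using tower(1) by (fastforce simp: zs_def in_set_conv_nth)
  have reg: "weakly_regular C C (zero_submodule C C) zs"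
    using weakly_regular_koszul[OF C, of zs K q w] tower(1,2) nzd K0
    by (fastforce simp: zs_def split: prod.splits)
  have thick_tower: "K t \<in> S"
    if S: "thick_subcategory T S" and "s \<le> t" "t \<le> ?t" "K s \<in> S" for S s t
    using that(2-)
  proof (induction t rule: dec_induct)
    case (step t)
    obtain d x where dx: "xs ! t = (d, x)" by force
    have "K t \<in> S" "Susp_pow T d (K t) \<in> S"
      using step S unfolding thick_subcategory_def by auto
    then show ?case
      using S tower(2)[of t d x] dx step.prems unfolding thick_subcategory_def by (meson Suc_le_lessD)
  qed
  have nil: "\<forall>(d, \<alpha>) \<in> set zs. nilpotent_on d \<alpha> (Susp_pow T n M)" for n
  proof safe
    fix d \<alpha> assume "(d, \<alpha>) \<in> set zs"
    then obtain s x where s: "s < ?t" "xs ! s = (d, x)" "\<alpha> = \<phi> d x"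
      by (auto simp: zs_def in_set_conv_nth)
    let ?S = "{X \<in> Obj T. nilpotent_on d \<alpha> X}"
    have S: "thick_subcategory T ?S" using thick_nilpotent_on[OF tower(1)[OF s(1,2)]] s(3) by simp
    have "K (Suc s) \<in> ?S"
      using koszul_nilpotent[OF tower(1,2)[OF s(1,2)]] s(3)
        Hom_Obj(2)[OF exact_triangle_Hom(2)[OF tower(2)[OF s(1,2)]]] by simp
    then have "K ?t \<in> ?S" using thick_tower[OF S, of "Suc s" ?t] s(1) by simp
    then have "M \<in> ?S" using thick_subset[OF S] assms(7) by blast
    then show "nilpotent_on d \<alpha> (Susp_pow T n M)"
      using S unfolding thick_subcategory_def by blast
  qed
  have not_level: "\<not> level_is T C k M" if k: "k \<le> ?t" for k
  proof
    assume lev: "level_is T C k M"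
    let ?S = "{X \<in> Obj T. \<forall>n. \<forall>f \<in> Hom T (Susp_pow T n M) X. f = ZeroMor T (Susp_pow T n M) X}"
    have S: "thick_subcategory T ?S" using thick_Hom_zero[OF M] .
    have "f = ZeroMor T (Susp_pow T n M) C" if f: "f \<in> Hom T (Susp_pow T n M) C" for n f
    proof -
      have "ghosts C ?t (Susp_pow T n M) C f"
        using nilpotent_imp_ghosts[OF C zs_center reg nil f] by (simp add: zs_def)
      then have "ghosts C k M (Susp_pow T (- n) C) (SuspMor_pow T (- n) f)"
        using ghosts_SuspMor_pow[OF C ghosts_mono[OF _ k], of "Susp_pow T n M" C f "- n"] M by simp
      then have "SuspMor_pow T (- n) f = ZeroMor T M (Susp_pow T (- n) C)"
        using ghosts_level[OF C lev] by blast
      then show ?thesis using SuspMor_pow_Zero_iff[OF f, of "- n"] M by simp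
    qed
    then have "C \<in> ?S" using C by blast
    then have "K ?t \<in> ?S" using thick_tower[OF S, of 0 ?t] K0 by simp
    then have "M \<in> ?S" using thick_subset[OF S] assms(7) by blast
    then have "\<forall>f \<in> Hom T (Susp_pow T 0 M) M. f = ZeroMor T (Susp_pow T 0 M) M" by blast
    then have "Ident T M = ZeroMor T M M" using Ident_Hom[OF M] by simp
    then show False using is_zero_objI[OF M] assms(8) by blast
  qed
  show ?thesis
    unfolding level_def
  proof (rule Inf_greatest)
    fix l assume "l \<in> {enat n | n. level_is T C n M}"
    then obtain n where "l = enat n" "level_is T C n M" by blast
    then show "enat (?t + 1) \<le> l" using not_level[of n] by (cases "n \<le> ?t") auto
  qed
qed

end
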